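(* Let $M$ be a differentiable manifold, $\gamma:J\to M$ a $C^1$ path ($J\subset\mathbb R$ an interval), and let $\{E_{i'}\}$ be a basis defined on $\gamma(J)$ in which the components of some $S$-derivation $\mathcal D^\gamma$ along $\gamma$ vanish. Let $U$ be a coordinate neighborhood such that on $U\cap\gamma(J)\neq\emptyset$ the path $\gamma$ is without self-intersections. Then there is a neighborhood of $U\cap\gamma(J)$ in $U$ in which $\{E_{i'}\}$ can be extended to a coordinate basis, i.e. in this neighborhood there exist local coordinates $\{x^{i'}\}$ such that $$E_{i'}|_{\gamma(s)}=\frac{\partial}{\partial x^{i'}}\Big|_{\gamma(s)}$$ at the points $\gamma(s)\in U$.
   Context: $S$ is a fixed map assigning to each $C^1$ vector field $X$ a tensor field $S_X$ of type $(1,1)$, regarded as a derivation of the tensor algebra over $M$; $D_X=L_X+S_X$, where $L_X$ is the Lie derivative along $X$. In a local basis $\{E_i\}$ of vector fields the components $W_X=[(W_X)^i_{\ j}]$ of $D_X$ are defined by $D_X(E_j)=(W_X)^i_{\ j}E_i$ (summation convention). Under a change $E_{i'}=A^i_{\ i'}E_i$ with $A=[A^i_{\ i'}]$ a nondegenerate matrix function, they become $A^{-1}(W_XA+X(A))$, where $X(A)$ is the entrywise action of $X$ on $A$. Let $X$ be a $C^1$ vector field defined on a neighborhood of $\gamma(J)$ with $X|_{\gamma(s)}=\dot\gamma(s)$ for $s\in J$. The restriction of $D_X$ to $\gamma(J)$ is called an $S$-derivation along $\gamma$ and denoted $\mathcal D^\gamma$: $(\mathcal D^\gamma T)|_{\gamma(s)}=(D_XT)|_{\gamma(s)}$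 for a $C^1$ tensor field $T$; this depends only on the values of $T$ on $\gamma(J)$. The components of $\mathcal D^\gamma$ are those of $D_X$ restricted to $\gamma(J)$. On $\gamma(J)$ the transformed components are $A^{-1}\big(W_X(\gamma(s))A(\gamma(s))+\frac{dA(\gamma(s))}{ds}\big)$, so they involve only the values of $A$ on $\gamma(J)$, and one can speak of the components of $\mathcal D^\gamma$ in a basis defined only on $\gamma(J)$.
   Formalization: "Without self-intersections" is taken to mean that γ restricted to γ⁻¹(U) is a homeomorphism onto U∩γ(J) (for compact J just injectivity), and "local coordinates" on the neighborhood means functions forming a chart near each of its points, not necessarily injective on all of it. *)

theory Defs
  imports "HOL-Analysis.Analysis"
begin

section \<open>Continuously differentiable maps\<close>

text \<open>Used for open sets \<^term>\<open>S\<close> and for relatively open subsets of nondegenerate intervals,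
  where the derivative is unique (one-sided at an endpoint of the interval).\<close>

definition C1_on :: "'a::real_normed_vector set \<Rightarrow> ('a \<Rightarrow> 'b::real_normed_vector) \<Rightarrow> bool" where
  "C1_on S f \<longleftrightarrow> (\<exists>f'. (\<forall>x\<in>S. (f has_derivative blinfun_apply (f' x)) (at x within S)) \<and>
     continuous_on S f')"

definition C2_on :: "'a::real_normed_vector set \<Rightarrow> ('a \<Rightarrow> 'b::real_normed_vector) \<Rightarrow> bool" where
  "C2_on S f \<longleftrightarrow> (\<exists>f'. (\<forall>x\<in>S. (f has_derivative blinfun_apply (f' x)) (at x within S)) \<and>
     C1_on S f')"

section \<open>Manifolds\<close>

text \<open>The manifold is a whole type. A chart is a pair of an open domain and a map into
  \<^typ>\<open>real^'n\<close> whose values outside the domain are irrelevant. Differentiability class two is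
  the least one for which vector fields of class one make sense; an atlas of higher
  class is in particular an atlas in the present sense.\<close>

type_synonym ('m, 'n) chart = "'m set \<times> ('m \<Rightarrow> real^'n)"

abbreviation chart_inv :: "('m, 'n::finite) chart \<Rightarrow> real^'n \<Rightarrow> 'm" where
  "chart_inv c \<equiv> inv_into (fst c) (snd c)"

definition is_chart :: "('m::topological_space, 'n::finite) chart \<Rightarrow> bool" where
  "is_chart c \<longleftrightarrow> open (fst c) \<and> open (snd c ` fst c) \<and>
     homeomorphism (fst c) (snd c ` fst c) (snd c) (chart_inv c)"

definition compatible :: "('m, 'n::finite) chart \<Rightarrow> ('m, 'n) chart \<Rightarrow> bool" where
  "compatible c d \<longleftrightarrow> C2_on (snd c ` (fst c \<inter> fst d)) (snd d \<circ> chart_inv c) \<and>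
     C2_on (snd d ` (fst c \<inter> fst d)) (snd c \<circ> chart_inv d)"

definition is_atlas :: "('m::topological_space, 'n::finite) chart set \<Rightarrow> bool" where
  "is_atlas M \<longleftrightarrow> (\<forall>c\<in>M. is_chart c) \<and> (\<Union>c\<in>M. fst c) = UNIV \<and> (\<forall>c\<in>M. \<forall>d\<in>M. compatible c d)"

text \<open>The maximal atlas containing \<^term>\<open>M\<close>; its members are the coordinate systems
  of the manifold.\<close>

definition charts :: "('m::topological_space, 'n::finite) chart set \<Rightarrow> ('m, 'n) chart set" where
  "charts M = {c. is_chart c \<and> (\<forall>d\<in>M. compatible c d)}"

definition differentiable_near :: "('m::topological_space, 'n::finite) chart set \<Rightarrow> 'm \<Rightarrow> ('m \<Rightarrow> real) \<Rightarrow> bool" where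
  "differentiable_near M p f \<longleftrightarrow>
     (\<exists>c\<in>charts M. p \<in> fst c \<and> (f \<circ> chart_inv c) differentiable (at (snd c p)))"

definition C2_near :: "('m::topological_space, 'n::finite) chart set \<Rightarrow> 'm \<Rightarrow> ('m \<Rightarrow> real) \<Rightarrow> bool" where
  "C2_near M p f \<longleftrightarrow>
     (\<exists>c\<in>charts M. p \<in> fst c \<and> C2_on (snd c ` fst c) (f \<circ> chart_inv c))"

section \<open>Tangent vectors and vector fields\<close>

text \<open>A tangent vector at a point is a first order differential operator
  acting on the functions differentiable at that point. It is set to zero on all other functions,
  so that equality of tangent vectors is equality of HOL functions.\<close>

type_synonym 'm tvec = "('m \<Rightarrow> real) \<Rightarrow> real"

text \<open>The vector with components \<^term>\<open>a\<close> in the coordinates \<^term>\<open>c\<close>.\<close>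

definition coord_vec :: "('m, 'n::finite) chart \<Rightarrow> 'm \<Rightarrow> real^'n \<Rightarrow> 'm tvec" where
  "coord_vec c p a = (\<lambda>f. if (f \<circ> chart_inv c) differentiable (at (snd c p))
     then frechet_derivative (f \<circ> chart_inv c) (at (snd c p)) a else 0)"

definition coord_basis :: "('m, 'n::finite) chart \<Rightarrow> 'n \<Rightarrow> 'm \<Rightarrow> 'm tvec" where
  "coord_basis c i p = coord_vec c p (axis i 1)"

definition coord_comp :: "('m, 'n::finite) chart \<Rightarrow> 'm tvec \<Rightarrow> real^'n" where
  "coord_comp c v = (\<chi> i. v (\<lambda>q. snd c q $ i))"

definition tangent_space :: "('m::topological_space, 'n::finite) chart set \<Rightarrow> 'm \<Rightarrow> 'm tvec set" where
  "tangent_space M p = {coord_vec c p a |c a. c \<in> charts M \<and> p \<in> fst c}"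

definition lincomb :: "real^'n::finite \<Rightarrow> ('n \<Rightarrow> 'm tvec) \<Rightarrow> 'm tvec" where
  "lincomb a e = (\<lambda>f. \<Sum>i\<in>UNIV. a $ i * e i f)"

definition tangent_basis :: "('m::topological_space, 'n::finite) chart set \<Rightarrow> 'm \<Rightarrow> ('n \<Rightarrow> 'm tvec) \<Rightarrow> bool" where
  "tangent_basis M p e \<longleftrightarrow> (\<forall>i. e i \<in> tangent_space M p) \<and>
     (\<forall>v\<in>tangent_space M p. \<exists>!a. v = lincomb a e)"

definition C1_fields :: "('m::topological_space, 'n::finite) chart set \<Rightarrow> 'm set \<Rightarrow> ('m \<Rightarrow> 'm tvec) set" where
  "C1_fields M N = {X \<in> (\<Pi>\<^sub>E p\<in>N. tangent_space M p).
     \<forall>c\<in>charts M. C1_on (snd c ` (fst c \<inter> N)) (\<lambda>u. coord_comp c (X (chart_inv c u)))}"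

definition local_frame :: "('m::topological_space, 'n::finite) chart set \<Rightarrow> 'm set \<Rightarrow> ('n \<Rightarrow> 'm \<Rightarrow> 'm tvec) \<Rightarrow> bool" where
  "local_frame M G F \<longleftrightarrow> open G \<and> (\<forall>i. F i \<in> C1_fields M G) \<and>
     (\<forall>p\<in>G. tangent_basis M p (\<lambda>i. F i p))"

section \<open>The derivation \<open>D\<^sub>X = L\<^sub>X + S\<^sub>X\<close>\<close>

text \<open>The Lie derivative of a vector field is the bracket. The bracket involves second
  derivatives of the test function, hence it is determined by its values on functions of
  class two; these determine a tangent vector, since they include local coordinates.\<close>

definition lie_deriv :: "('m::topological_space, 'n::finite) chart set \<Rightarrow> ('m \<Rightarrow> 'm tvec) \<Rightarrow> ('m \<Rightarrow> 'm tvec) \<Rightarrow> 'm \<Rightarrow> 'm tvec" where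
  "lie_deriv M X Y p = (THE Z. Z \<in> tangent_space M p \<and>
     (\<forall>f. C2_near M p f \<longrightarrow> Z f = X p (\<lambda>q. Y q f) - Y p (\<lambda>q. X q f)))"

text \<open>Tensors of type \<open>(1,1)\<close>, as linear endomorphisms of the tangent space.\<close>

definition endomorphisms :: "('m::topological_space, 'n::finite) chart set \<Rightarrow> 'm \<Rightarrow> ('m tvec \<Rightarrow> 'm tvec) set" where
  "endomorphisms M p = {\<tau> \<in> tangent_space M p \<rightarrow>\<^sub>E tangent_space M p.
     \<forall>u\<in>tangent_space M p. \<forall>v\<in>tangent_space M p. \<forall>a b.
       \<tau> (\<lambda>f. a * u f + b * v f) = (\<lambda>f. a * \<tau> u f + b * \<tau> v f)}"

text \<open>\<^term>\<open>S N X\<close> is the tensor field assigned to the vector field \<^term>\<open>X\<close> with open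
  domain \<^term>\<open>N\<close>. The assignment is not required to be linear or local, and the tensor field need not
  be continuous.\<close>

type_synonym 'm tensor_map = "'m set \<Rightarrow> ('m \<Rightarrow> 'm tvec) \<Rightarrow> 'm \<Rightarrow> 'm tvec \<Rightarrow> 'm tvec"

definition tensor_map :: "('m::topological_space, 'n::finite) chart set \<Rightarrow> 'm tensor_map \<Rightarrow> bool" where
  "tensor_map M S \<longleftrightarrow>
     (\<forall>N. open N \<longrightarrow> (\<forall>X\<in>C1_fields M N. S N X \<in> (\<Pi>\<^sub>E p\<in>N. endomorphisms M p)))"

text \<open>The action on vector fields determines the derivation, and it is all that enters
  the components.\<close>

definition S_deriv :: "('m::topological_space, 'n::finite) chart set \<Rightarrow> 'm tensor_map \<Rightarrow> 'm set \<Rightarrow>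
    ('m \<Rightarrow> 'm tvec) \<Rightarrow> ('m \<Rightarrow> 'm tvec) \<Rightarrow> 'm \<Rightarrow> 'm tvec" where
  "S_deriv M S N X Y p = (\<lambda>f. lie_deriv M X Y p f + S N X p (Y p) f)"

text \<open>\<open>D\<^sub>X F\<^sub>j = W\<^sup>i\<^sub>j F\<^sub>i\<close>, with \<open>W\<^sup>i\<^sub>j\<close> in row \<open>i\<close> and column \<open>j\<close>.\<close>

definition S_components :: "('m::topological_space, 'n::finite) chart set \<Rightarrow> 'm tensor_map \<Rightarrow> 'm set \<Rightarrow>
    ('m \<Rightarrow> 'm tvec) \<Rightarrow> ('n \<Rightarrow> 'm \<Rightarrow> 'm tvec) \<Rightarrow> 'm \<Rightarrow> real^'n^'n" where
  "S_components M S N X F p =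
     (THE W. \<forall>j. S_deriv M S N X (F j) p = lincomb (column j W) (\<lambda>i. F i p))"

section \<open>Paths and derivations along them\<close>

definition C1_path :: "('m::topological_space, 'n::finite) chart set \<Rightarrow> real set \<Rightarrow> (real \<Rightarrow> 'm) \<Rightarrow> bool" where
  "C1_path M J \<gamma> \<longleftrightarrow> is_interval J \<and> interior J \<noteq> {} \<and> continuous_on J \<gamma> \<and>
     (\<forall>c\<in>charts M. C1_on (J \<inter> \<gamma> -` fst c) (snd c \<circ> \<gamma>))"

definition velocity :: "('m::topological_space, 'n::finite) chart set \<Rightarrow> real set \<Rightarrow> (real \<Rightarrow> 'm) \<Rightarrow> real \<Rightarrow> 'm tvec" where
  "velocity M J \<gamma> s = (\<lambda>f. if differentiable_near M (\<gamma> s) f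
     then vector_derivative (\<lambda>t. f (\<gamma> t)) (at s within J) else 0)"

definition frame_along :: "('m::topological_space, 'n::finite) chart set \<Rightarrow> real set \<Rightarrow> (real \<Rightarrow> 'm) \<Rightarrow>
    ('n \<Rightarrow> 'm \<Rightarrow> 'm tvec) \<Rightarrow> bool" where
  "frame_along M J \<gamma> E \<longleftrightarrow> (\<forall>p\<in>\<gamma> ` J. tangent_basis M p (\<lambda>i. E i p)) \<and>
     (\<forall>c\<in>charts M. \<forall>i. C1_on (J \<inter> \<gamma> -` fst c) (\<lambda>s. coord_comp c (E i (\<gamma> s))))"

text \<open>\<^term>\<open>X\<close>, with domain \<^term>\<open>N\<close>, defines an \<open>S\<close>-derivation along \<^term>\<open>\<gamma>\<close>.\<close>

definition extends_velocity :: "('m::topological_space, 'n::finite) chart set \<Rightarrow> real set \<Rightarrow> (real \<Rightarrow> 'm) \<Rightarrow>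
    'm set \<Rightarrow> ('m \<Rightarrow> 'm tvec) \<Rightarrow> bool" where
  "extends_velocity M J \<gamma> N X \<longleftrightarrow> open N \<and> \<gamma> ` J \<subseteq> N \<and> X \<in> C1_fields M N \<and>
     (\<forall>s\<in>J. X (\<gamma> s) = velocity M J \<gamma> s)"

text \<open>The matrix \<open>A\<close> in \<open>E\<^sub>j = A\<^sup>i\<^sub>j F\<^sub>i\<close>.\<close>

definition transition_matrix :: "('n::finite \<Rightarrow> 'm \<Rightarrow> 'm tvec) \<Rightarrow> ('n \<Rightarrow> 'm \<Rightarrow> 'm tvec) \<Rightarrow> 'm \<Rightarrow> real^'n^'n" where
  "transition_matrix F E p = (THE A. \<forall>j. E j p = lincomb (column j A) (\<lambda>i. F i p))"

text \<open>\<^term>\<open>\<Gamma>\<close> are the components, in the basis \<^term>\<open>E\<close> on \<open>\<gamma>(J)\<close>, of the \<open>S\<close>-derivation along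
  \<^term>\<open>\<gamma>\<close> given by \<^term>\<open>X\<close>. Since \<^term>\<open>E\<close> need not extend to a
  frame, they are obtained by the transformation law from the components in
  local frames \<^term>\<open>F\<close>; the result does not depend on \<^term>\<open>F\<close>, and a local frame (such as
  a coordinate one) exists around every point.\<close>

definition path_components :: "('m::topological_space, 'n::finite) chart set \<Rightarrow> 'm tensor_map \<Rightarrow> 'm set \<Rightarrow>
    ('m \<Rightarrow> 'm tvec) \<Rightarrow> real set \<Rightarrow> (real \<Rightarrow> 'm) \<Rightarrow> ('n \<Rightarrow> 'm \<Rightarrow> 'm tvec) \<Rightarrow> (real \<Rightarrow> real^'n^'n) \<Rightarrow> bool" where
  "path_components M S N X J \<gamma> E \<Gamma> \<longleftrightarrow>
     (\<forall>s\<in>J. \<forall>G F. local_frame M G F \<and> \<gamma> s \<in> G \<and> G \<subseteq> N \<longrightarrow>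
        (let A = (\<lambda>t. transition_matrix F E (\<gamma> t)) in
         \<Gamma> s = matrix_inv (A s) **
           (S_components M S N X F (\<gamma> s) ** A s + vector_derivative A (at s within J))))"

text \<open>The part of the path in \<^term>\<open>U\<close> neither meets itself nor accumulates on itself. Injectivity
  alone would admit, for noncompact \<^term>\<open>J\<close>, a dense line on a torus or a circle
  parametrised by a half-open interval. For compact \<^term>\<open>J\<close> it is equivalent, as
  shown below.\<close>

definition no_self_intersections :: "real set \<Rightarrow> (real \<Rightarrow> 'm::topological_space) \<Rightarrow> 'm set \<Rightarrow> bool" where
  "no_self_intersections J \<gamma> U \<longleftrightarrow> (\<exists>g. homeomorphism (J \<inter> \<gamma> -` U) (U \<inter> \<gamma> ` J) \<gamma> g)"

lemma no_self_intersections_compact_iff: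
  fixes \<gamma> :: "real \<Rightarrow> 'm::t2_space"
  assumes J: "compact J" and cont: "continuous_on J \<gamma>"
  shows "no_self_intersections J \<gamma> U \<longleftrightarrow> inj_on \<gamma> (J \<inter> \<gamma> -` U)"
proof
  assume "no_self_intersections J \<gamma> U"
  then show "inj_on \<gamma> (J \<inter> \<gamma> -` U)"
    unfolding no_self_intersections_def homeomorphism_def by (metis inj_on_inverseI)
next
  assume inj: "inj_on \<gamma> (J \<inter> \<gamma> -` U)"
  have "continuous_on (J \<inter> \<gamma> -` U) \<gamma>"
    using cont by (rule continuous_on_subset) auto
  moreover have "\<gamma> ` (J \<inter> \<gamma> -` U) = U \<inter> \<gamma> ` J"
    by auto
  moreover have "closedin (top_of_set (U \<inter> \<gamma> ` J)) (\<gamma> ` K)"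
    if "closedin (top_of_set (J \<inter> \<gamma> -` U)) K" for K
  proof -
    obtain T where T: "closed T" "K = J \<inter> \<gamma> -` U \<inter> T"
      using \<open>closedin (top_of_set (J \<inter> \<gamma> -` U)) K\<close> by (auto simp: closedin_closed)
    have "compact (\<gamma> ` (J \<inter> T))"
      using J T(1) cont
      by (meson compact_Int_closed compact_continuous_image continuous_on_subset inf_le1)
    then have "closed (\<gamma> ` (J \<inter> T))"
      by (rule compact_imp_closed)
    moreover have "\<gamma> ` K = (U \<inter> \<gamma> ` J) \<inter> \<gamma> ` (J \<inter> T)"
      using T(2) by auto
    ultimately show ?thesis
      by (metis closedin_closed)
  qed
  ultimately show "no_self_intersections J \<gamma> U"
    unfolding no_self_intersections_def
    using homeomorphism_injective_closed_map[OF _ _ inj] by metis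
qed

text \<open>Local coordinates on \<^term>\<open>V\<close>, in the sense that each point of \<^term>\<open>V\<close> has a neighborhood on
  which \<^term>\<open>x\<close> is a chart; then the vectors \<open>\<partial>/\<partial>x\<^sup>i\<close> form a basis at each point of \<^term>\<open>V\<close>.
  Injectivity on the whole of \<^term>\<open>V\<close> is not part of it: if \<open>E\<^sub>i\<close> is the standard
  frame of the plane turned by the angle \<open>-2\<pi>s\<close> at the point \<open>(s,0)\<close>, with \<open>0 \<le> s \<le> 1\<close>, then
  \<open>\<partial>/\<partial>x\<^sup>i = E\<^sub>i\<close> forces \<open>x(s,0)\<close> to run around a full circle.\<close>

definition local_coordinates :: "('m::topological_space, 'n::finite) chart set \<Rightarrow> 'm set \<Rightarrow> ('m \<Rightarrow> real^'n) \<Rightarrow> bool" where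
  "local_coordinates M V x \<longleftrightarrow> (\<forall>p\<in>V. \<exists>G. p \<in> G \<and> G \<subseteq> V \<and> (G, x) \<in> charts M)"

end

theory Submission
  imports Defs
begin

text \<open>
  Let \<open>c = u \<circ> \<gamma>\<close> be the path in the given coordinates, \<open>e\<^sub>i s\<close> the components of \<open>E\<^sub>i\<close> at \<open>\<gamma> s\<close>, and \<open>T s\<close> the
  inverse of the matrix with columns \<open>e\<^sub>i s\<close>. Coordinates of the form \<open>\<xi> \<circ> u\<close> have the vectors \<open>E\<^sub>i\<close> as
  coordinate basis at \<open>\<gamma> s\<close> exactly if the derivative of \<open>\<xi>\<close> at \<open>c s\<close> is \<open>T s\<close>. So the
  task is to find a map \<open>\<xi>\<close> of class two near a curve whose derivative along the curve is a prescribed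
  invertible \<open>T\<close> of class one. The inverse function theorem then makes \<open>\<xi> \<circ> u\<close> a chart near each point of the path
  (\<open>chart_of_local_diffeomorphism\<close>).

  At a stationary point of the curve there need not be such a \<open>\<xi>\<close>, since \<open>T\<close> could change faster than the
  position. The path has none in \<open>U\<close>: it is an integral curve of the field \<open>X\<close> of class one, so by
  uniqueness of solutions it would rest at a zero of \<open>X\<close>, but it does not meet itself (\<open>injective_solution_regular\<close>). The same equation
  shows that \<open>c\<close> is of class two.

  The values of \<open>\<xi>\<close> on the curve are a primitive \<open>F\<close> of \<open>T c'\<close>. Off the curve, adding the linear term
  \<open>T s (y - c s)\<close> to \<open>F s\<close>, with \<open>s\<close> a parameter assigned to \<open>y\<close>, would be correct to first order,
  but it is only of class one. For every basis vector \<open>b\<close>, with \<open>t\<close> the component of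
  \<open>y - c s\<close> along \<open>b\<close>, the term \<open>t T s b\<close> is therefore replaced by \<open>(P (s + t) - P (s - t)) b / 2\<close>, where
  \<open>P' = T\<close>; this gains the missing derivative (\<open>C2_local_prescribed_derivative\<close>). Since all local solutions have the same values and
  derivatives on the curve, a partition of unity glues them (\<open>C2_glue_prescribed_derivatives\<close>).
\<close>

section \<open>Calculus of maps of class one and two\<close>

lemma C1_onI:
  assumes "\<And>x. x \<in> S \<Longrightarrow> (f has_derivative blinfun_apply (f' x)) (at x within S)"
    and "continuous_on S f'"
  shows "C1_on S f"
  using assms unfolding C1_on_def by blast

lemma C2_onI:
  assumes "\<And>x. x \<in> S \<Longrightarrow> (f has_derivative blinfun_apply (f' x)) (at x within S)"
    and "C1_on S f'"
  shows "C2_on S f"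
  using assms unfolding C2_on_def by blast

lemma C1_on_imp_continuous_on: "C1_on S f \<Longrightarrow> continuous_on S f"
  unfolding C1_on_def by (meson has_derivative_continuous continuous_on_eq_continuous_within)

lemma C2_on_imp_C1_on: "C2_on S f \<Longrightarrow> C1_on S f"
  unfolding C2_on_def C1_on_def[of S f] using C1_on_imp_continuous_on by blast

lemma C1_on_subset: "C1_on S f \<Longrightarrow> T \<subseteq> S \<Longrightarrow> C1_on T f"
  unfolding C1_on_def by (meson continuous_on_subset has_derivative_subset subsetD)

lemma C2_on_subset: "C2_on S f \<Longrightarrow> T \<subseteq> S \<Longrightarrow> C2_on T f"
  unfolding C2_on_def by (meson C1_on_subset has_derivative_subset subsetD)

lemma C1_on_cong:
  assumes "\<And>x. x \<in> S \<Longrightarrow> f x = g x"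
  shows "C1_on S f \<longleftrightarrow> C1_on S g"
proof -
  have "(f has_derivative D) (at x within S) \<longleftrightarrow> (g has_derivative D) (at x within S)" if "x \<in> S" for x D
    using has_derivative_transform[OF that, of f g D] has_derivative_transform[OF that, of g f D] assms
    by auto
  then show ?thesis unfolding C1_on_def by (simp cong: ball_cong conj_cong)
qed

lemma C2_on_cong:
  assumes "\<And>x. x \<in> S \<Longrightarrow> f x = g x"
  shows "C2_on S f \<longleftrightarrow> C2_on S g"
proof -
  have "(f has_derivative D) (at x within S) \<longleftrightarrow> (g has_derivative D) (at x within S)" if "x \<in> S" for x D
    using has_derivative_transform[OF that, of f g D] has_derivative_transform[OF that, of g f D] assms
    by auto
  then show ?thesis unfolding C2_on_def by (simp cong: ball_cong conj_cong)
qed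

lemma C1_on_derivative:
  assumes "C1_on S f"
  obtains f' where "\<And>x. x \<in> S \<Longrightarrow> (f has_derivative blinfun_apply (f' x)) (at x within S)"
    "continuous_on S f'"
  using assms unfolding C1_on_def by blast

lemma C2_on_derivative:
  assumes "C2_on S f"
  obtains f' where "\<And>x. x \<in> S \<Longrightarrow> (f has_derivative blinfun_apply (f' x)) (at x within S)"
    "C1_on S f'"
  using assms unfolding C2_on_def by blast

lemma C1_on_const: "C1_on S (\<lambda>x. c)"
  by (rule C1_onI[where f'="\<lambda>_. 0"]) (auto simp: zero_blinfun.rep_eq)

lemma C2_on_const: "C2_on S (\<lambda>x. c)"
  by (rule C2_onI[where f'="\<lambda>_. 0"]) (auto simp: zero_blinfun.rep_eq C1_on_const)

lemma C2_on_bounded_linear: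
  assumes "bounded_linear L" shows "C2_on S L"
proof (rule C2_onI[where f'="\<lambda>_. Blinfun L"])
  show "(L has_derivative blinfun_apply (Blinfun L)) (at x within S)" for x
    using assms by (simp add: bounded_linear_Blinfun_apply bounded_linear_imp_has_derivative)
qed (rule C1_on_const)

lemma C1_on_bounded_linear: "bounded_linear L \<Longrightarrow> C1_on S L"
  by (intro C2_on_imp_C1_on C2_on_bounded_linear)

lemma C1_on_compose:
  assumes g: "C1_on T g" and f: "C1_on S f" and "f ` S \<subseteq> T"
  shows "C1_on S (\<lambda>x. g (f x))"
proof -
  obtain g' where g': "\<And>x. x \<in> T \<Longrightarrow> (g has_derivative blinfun_apply (g' x)) (at x within T)"
    "continuous_on T g'" using g by (rule C1_on_derivative) blast
  obtain f' where f': "\<And>x. x \<in> S \<Longrightarrow> (f has_derivative blinfun_apply (f' x)) (at x within S)"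
    "continuous_on S f'" using f by (rule C1_on_derivative) blast
  show ?thesis
  proof (rule C1_onI[where f'="\<lambda>x. g' (f x) o\<^sub>L f' x"])
    show "((\<lambda>x. g (f x)) has_derivative blinfun_apply (g' (f x) o\<^sub>L f' x)) (at x within S)"
      if "x \<in> S" for x
      using has_derivative_in_compose2[OF g'(1) assms(3) that f'(1)[OF that]]
      by (simp add: blinfun_compose.rep_eq comp_def)
    have "continuous_on S (\<lambda>x. g' (f x))"
      using continuous_on_compose2[OF g'(2) C1_on_imp_continuous_on[OF f] assms(3)] .
    then show "continuous_on S (\<lambda>x. g' (f x) o\<^sub>L f' x)"
      using f'(2) by (intro continuous_intros)
  qed
qed

lemma C1_on_add:
  assumes "C1_on S f" "C1_on S g" shows "C1_on S (\<lambda>x. f x + g x)"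
proof -
  obtain g' where g': "\<And>x. x \<in> S \<Longrightarrow> (g has_derivative blinfun_apply (g' x)) (at x within S)"
    "continuous_on S g'" using assms(2) by (rule C1_on_derivative) blast
  obtain f' where f': "\<And>x. x \<in> S \<Longrightarrow> (f has_derivative blinfun_apply (f' x)) (at x within S)"
    "continuous_on S f'" using assms(1) by (rule C1_on_derivative) blast
  show ?thesis
    by (rule C1_onI[where f'="\<lambda>x. f' x + g' x"])
      (auto intro!: continuous_intros f' g' has_derivative_add simp: plus_blinfun.rep_eq)
qed

lemma C2_on_add:
  assumes "C2_on S f" "C2_on S g" shows "C2_on S (\<lambda>x. f x + g x)"
proof -
  obtain g' where g': "\<And>x. x \<in> S \<Longrightarrow> (g has_derivative blinfun_apply (g' x)) (at x within S)"
    "C1_on S g'" using assms(2) by (rule C2_on_derivative) blast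
  obtain f' where f': "\<And>x. x \<in> S \<Longrightarrow> (f has_derivative blinfun_apply (f' x)) (at x within S)"
    "C1_on S f'" using assms(1) by (rule C2_on_derivative) blast
  show ?thesis
    by (rule C2_onI[where f'="\<lambda>x. f' x + g' x"])
      (auto intro!: C1_on_add f' g' has_derivative_add simp: plus_blinfun.rep_eq)
qed

lemma C1_on_linear_image: "bounded_linear L \<Longrightarrow> C1_on S f \<Longrightarrow> C1_on S (\<lambda>x. L (f x))"
  by (rule C1_on_compose[OF C1_on_bounded_linear[where S=UNIV]]) auto

lemma bounded_linear_pair_left: "bounded_linear (\<lambda>a. (a, 0))"
  by (intro bounded_linear_Pair bounded_linear_ident bounded_linear_zero)

lemma bounded_linear_pair_right: "bounded_linear (\<lambda>b. (0, b))"
  by (intro bounded_linear_Pair bounded_linear_ident bounded_linear_zero)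

lemma C1_on_Pair:
  assumes "C1_on S f" "C1_on S g" shows "C1_on S (\<lambda>x. (f x, g x))"
  using C1_on_add[OF C1_on_linear_image[OF bounded_linear_pair_left assms(1)]
      C1_on_linear_image[OF bounded_linear_pair_right assms(2)]] by simp

text \<open>The derivative of a bounded bilinear map depends linearly on the point, so such a map is
  smooth; together with composition and pairing this yields all product rules at once.\<close>

lemma C2_on_bilinear_pair:
  fixes bop :: "'a::real_normed_vector \<Rightarrow> 'b::real_normed_vector \<Rightarrow> 'c::real_normed_vector"
  assumes "bounded_bilinear bop"
  shows "C2_on UNIV (\<lambda>p. bop (fst p) (snd p))"
proof -
  interpret bounded_bilinear bop by fact
  define D where "D p h = bop (fst p) (snd h) + bop (fst h) (snd p)" for p h
  have lin: "bounded_linear (D p)" for p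
    unfolding D_def
    by (intro bounded_linear_add bounded_linear_compose[OF bounded_linear_right bounded_linear_snd]
        bounded_linear_compose[OF bounded_linear_left bounded_linear_fst])
  have app: "blinfun_apply (Blinfun (D p)) = D p" for p
    by (rule bounded_linear_Blinfun_apply[OF lin])
  obtain K where K: "0 \<le> K" "\<And>a b. norm (bop a b) \<le> norm a * norm b * K"
    using nonneg_bounded by blast
  have "bounded_linear (\<lambda>p. Blinfun (D p))"
  proof (rule bounded_linear_intro[where K="2 * K"])
    show "Blinfun (D (x + y)) = Blinfun (D x) + Blinfun (D y)" for x y
      by (rule blinfun_eqI) (simp add: app plus_blinfun.rep_eq, simp add: D_def add_left add_right)
    show "Blinfun (D (r *\<^sub>R x)) = r *\<^sub>R Blinfun (D x)" for r x
      by (rule blinfun_eqI)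
        (simp add: app scaleR_blinfun.rep_eq, simp add: D_def scaleR_left scaleR_right scaleR_add_right)
    show "norm (Blinfun (D x)) \<le> norm x * (2 * K)" for x
    proof (rule norm_blinfun_bound)
      show "norm (blinfun_apply (Blinfun (D x)) h) \<le> norm x * (2 * K) * norm h" for h
      proof -
        have "norm (D x h) \<le> norm (fst x) * norm (snd h) * K + norm (fst h) * norm (snd x) * K"
          unfolding D_def by (rule norm_triangle_le) (intro add_mono K)
        also have "\<dots> \<le> norm x * norm h * K + norm h * norm x * K"
          using norm_fst_le[of "fst x" "snd x"] norm_snd_le[of "snd x" "fst x"]
            norm_fst_le[of "fst h" "snd h"] norm_snd_le[of "snd h" "fst h"] K(1)
          by (intro add_mono mult_right_mono mult_mono) auto
        finally show ?thesis by (simp add: app algebra_simps)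
      qed
    qed (use K(1) in auto)
  qed
  then have "C1_on UNIV (\<lambda>p. Blinfun (D p))"
    by (rule C1_on_bounded_linear)
  moreover have "((\<lambda>p. bop (fst p) (snd p)) has_derivative D x) (at x)" for x
    unfolding D_def by (auto intro!: derivative_eq_intros FDERIV)
  ultimately show ?thesis
    by (intro C2_onI[where f'="\<lambda>p. Blinfun (D p)"]) (auto simp: app)
qed

lemma C1_on_bilinear:
  assumes "bounded_bilinear bop" "C1_on S f" "C1_on S g"
  shows "C1_on S (\<lambda>x. bop (f x) (g x))"
  using C1_on_compose[OF C2_on_imp_C1_on[OF C2_on_bilinear_pair[OF assms(1)]]
      C1_on_Pair[OF assms(2,3)]] by simp

lemmas C1_on_blinfun_compose = C1_on_bilinear[OF bounded_bilinear_blinfun_compose]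

lemma C2_on_compose:
  assumes g: "C2_on T g" and f: "C2_on S f" and "f ` S \<subseteq> T"
  shows "C2_on S (\<lambda>x. g (f x))"
proof -
  obtain g' where g': "\<And>x. x \<in> T \<Longrightarrow> (g has_derivative blinfun_apply (g' x)) (at x within T)"
    "C1_on T g'" using g by (rule C2_on_derivative) blast
  obtain f' where f': "\<And>x. x \<in> S \<Longrightarrow> (f has_derivative blinfun_apply (f' x)) (at x within S)"
    "C1_on S f'" using f by (rule C2_on_derivative) blast
  show ?thesis
  proof (rule C2_onI[where f'="\<lambda>x. g' (f x) o\<^sub>L f' x"])
    show "((\<lambda>x. g (f x)) has_derivative blinfun_apply (g' (f x) o\<^sub>L f' x)) (at x within S)"
      if "x \<in> S" for x
      using has_derivative_in_compose2[OF g'(1) assms(3) that f'(1)[OF that]]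
      by (simp add: blinfun_compose.rep_eq comp_def)
    show "C1_on S (\<lambda>x. g' (f x) o\<^sub>L f' x)"
      by (intro C1_on_blinfun_compose f'(2) C1_on_compose[OF g'(2) C2_on_imp_C1_on[OF f] assms(3)])
  qed
qed

lemma C2_on_linear_image: "bounded_linear L \<Longrightarrow> C2_on S f \<Longrightarrow> C2_on S (\<lambda>x. L (f x))"
  by (rule C2_on_compose[OF C2_on_bounded_linear[where S=UNIV]]) auto

lemma C2_on_Pair:
  assumes "C2_on S f" "C2_on S g" shows "C2_on S (\<lambda>x. (f x, g x))"
  using C2_on_add[OF C2_on_linear_image[OF bounded_linear_pair_left assms(1)]
      C2_on_linear_image[OF bounded_linear_pair_right assms(2)]] by simp

lemma C2_on_bilinear:
  assumes "bounded_bilinear bop" "C2_on S f" "C2_on S g"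
  shows "C2_on S (\<lambda>x. bop (f x) (g x))"
  using C2_on_compose[OF C2_on_bilinear_pair[OF assms(1)] C2_on_Pair[OF assms(2,3)]] by simp

lemmas C2_on_scaleR = C2_on_bilinear[OF bounded_bilinear_scaleR]
lemmas C2_on_mult = C2_on_bilinear[OF bounded_bilinear_mult]
lemmas C2_on_inner = C2_on_bilinear[OF bounded_bilinear_inner]

lemma C2_on_ident: "C2_on S (\<lambda>x. x)"
  by (rule C2_on_bounded_linear) (rule bounded_linear_ident)

lemma C2_on_minus: "C2_on S f \<Longrightarrow> C2_on S (\<lambda>x. - f x)"
  by (rule C2_on_linear_image) (intro bounded_linear_intros bounded_linear_minus bounded_linear_ident)

lemma C2_on_diff: "C2_on S f \<Longrightarrow> C2_on S g \<Longrightarrow> C2_on S (\<lambda>x. f x - g x)"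
  using C2_on_add[OF _ C2_on_minus, of S f g] by simp

lemma C1_on_sum:
  assumes "\<And>i. i \<in> I \<Longrightarrow> C1_on S (f i)"
  shows "C1_on S (\<lambda>x. \<Sum>i\<in>I. f i x)"
  using assms
  by (induction I rule: infinite_finite_induct) (auto intro: C1_on_const C1_on_add)

lemma C2_on_sum:
  assumes "\<And>i. i \<in> I \<Longrightarrow> C2_on S (f i)"
  shows "C2_on S (\<lambda>x. \<Sum>i\<in>I. f i x)"
  using assms
  by (induction I rule: infinite_finite_induct) (auto intro: C2_on_const C2_on_add)

text \<open>On an open set the derivative is unique, so local derivatives fit together.\<close>

lemma C1_on_locally:
  assumes "\<And>x. x \<in> S \<Longrightarrow> \<exists>W. open W \<and> x \<in> W \<and> C1_on W f"
  shows "C1_on S f"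
proof -
  define f' where "f' x = Blinfun (frechet_derivative f (at x))" for x
  have *: "(f has_derivative blinfun_apply (f' x)) (at x) \<and> isCont f' x" if "x \<in> S" for x
  proof -
    obtain W where W: "open W" "x \<in> W" "C1_on W f" using assms \<open>x \<in> S\<close> by blast
    obtain g' where g': "\<And>x. x \<in> W \<Longrightarrow> (f has_derivative blinfun_apply (g' x)) (at x within W)"
      "continuous_on W g'" using W(3) by (rule C1_on_derivative) blast
    have eq: "f' y = g' y" if "y \<in> W" for y
      using g'(1)[OF that] at_within_open[OF that W(1)] frechet_derivative_at[of f _ y]
      unfolding f'_def by (metis blinfun_apply_inverse)
    have "isCont g' x" using g'(2) W by (simp add: continuous_on_eq_continuous_at)
    moreover have "eventually (\<lambda>y. g' y = f' y) (nhds x)"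
      using W eq by (auto simp: eventually_nhds intro!: exI[of _ W])
    ultimately have "isCont f' x" using isCont_cong by blast
    then show ?thesis using g'(1)[OF W(2)] eq[OF W(2)] at_within_open[OF W(2) W(1)] by simp
  qed
  show ?thesis
  proof (rule C1_onI[where f'=f'])
    show "(f has_derivative blinfun_apply (f' x)) (at x within S)" if "x \<in> S" for x
      using *[OF that] has_derivative_at_withinI by blast
    show "continuous_on S f'"
      using * by (simp add: continuous_at_imp_continuous_on)
  qed
qed

lemma C2_on_locally:
  assumes "\<And>x. x \<in> S \<Longrightarrow> \<exists>W. open W \<and> x \<in> W \<and> C2_on W f"
  shows "C2_on S f"
proof -
  define f' where "f' x = Blinfun (frechet_derivative f (at x))" for x
  have *: "(f has_derivative blinfun_apply (f' x)) (at x) \<and> (\<exists>W. open W \<and> x \<in> W \<and> C1_on W f')"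
    if "x \<in> S" for x
  proof -
    obtain W where W: "open W" "x \<in> W" "C2_on W f" using assms \<open>x \<in> S\<close> by blast
    obtain g' where g': "\<And>x. x \<in> W \<Longrightarrow> (f has_derivative blinfun_apply (g' x)) (at x within W)"
      "C1_on W g'" using W(3) by (rule C2_on_derivative) blast
    have eq: "f' y = g' y" if "y \<in> W" for y
      using g'(1)[OF that] at_within_open[OF that W(1)] frechet_derivative_at[of f _ y]
      unfolding f'_def by (metis blinfun_apply_inverse)
    have "C1_on W f'" using g'(2) C1_on_cong[of W f' g'] eq by blast
    then show ?thesis using g'(1)[OF W(2)] eq[OF W(2)] at_within_open[OF W(2) W(1)] W by auto
  qed
  show ?thesis
  proof (rule C2_onI[where f'=f'])
    show "(f has_derivative blinfun_apply (f' x)) (at x within S)" if "x \<in> S" for x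
      using *[OF that] has_derivative_at_withinI by blast
    show "C1_on S f'"
      by (rule C1_on_locally) (use * in blast)
  qed
qed

lemma C1_on_vector_derivative:
  assumes "\<And>s. s \<in> S \<Longrightarrow> (f has_vector_derivative f' s) (at s within S)" and "continuous_on S f'"
  shows "C1_on S f"
proof (rule C1_onI[where f'="\<lambda>s. blinfun_scaleR_left (f' s)"])
  show "continuous_on S (\<lambda>s. blinfun_scaleR_left (f' s))"
    by (intro bounded_linear.continuous_on[OF bounded_linear_blinfun_scaleR_left] assms)
qed (use assms in \<open>simp add: has_vector_derivative_def\<close>)

lemma C2_on_vector_derivative:
  assumes "\<And>s. s \<in> S \<Longrightarrow> (f has_vector_derivative f' s) (at s within S)" and "C1_on S f'"
  shows "C2_on S f"
proof (rule C2_onI[where f'="\<lambda>s. blinfun_scaleR_left (f' s)"])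
  show "C1_on S (\<lambda>s. blinfun_scaleR_left (f' s))"
    by (intro C1_on_linear_image[OF bounded_linear_blinfun_scaleR_left] assms)
qed (use assms in \<open>simp add: has_vector_derivative_def\<close>)

lemma C1_on_obtain_vector_derivative:
  fixes f :: "real \<Rightarrow> 'b::real_normed_vector"
  assumes "C1_on S f"
  obtains f' where "\<And>s. s \<in> S \<Longrightarrow> (f has_vector_derivative f' s) (at s within S)" "continuous_on S f'"
proof -
  obtain D where D: "\<And>s. s \<in> S \<Longrightarrow> (f has_derivative blinfun_apply (D s)) (at s within S)"
    "continuous_on S D" using assms by (rule C1_on_derivative) blast
  show thesis
  proof (rule that)
    show "(f has_vector_derivative D s 1) (at s within S)" if "s \<in> S" for s
    proof -
      have "D s h = h *\<^sub>R D s 1" for h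
        by (metis blinfun.scaleR_right mult.right_neutral real_scaleR_def)
      then have "blinfun_apply (D s) = (\<lambda>h. h *\<^sub>R D s 1)" by blast
      then show ?thesis using D(1)[OF that] unfolding has_vector_derivative_def by metis
    qed
    show "continuous_on S (\<lambda>s. D s 1)" using D(2) by (intro continuous_intros)
  qed
qed

section \<open>Inverses of operators and of maps\<close>

text \<open>The identity \<open>T w - T z = - T w (A w - A z) T z\<close> bounds \<open>T w\<close> near \<open>z\<close> by \<open>2 \<parallel>T z\<parallel>\<close>,
  and with this bound it gives continuity.\<close>

lemma continuous_on_blinfun_inverse:
  fixes A :: "'a::topological_space \<Rightarrow> 'b::real_normed_vector \<Rightarrow>\<^sub>L 'c::real_normed_vector"
  assumes A: "continuous_on S A"
    and TA: "\<And>x. x \<in> S \<Longrightarrow> T x o\<^sub>L A x = id_blinfun"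
    and AT: "\<And>x. x \<in> S \<Longrightarrow> A x o\<^sub>L T x = id_blinfun"
  shows "continuous_on S T"
  unfolding continuous_on_def
proof
  fix z assume z: "z \<in> S"
  define a where "a w = norm (A w - A z)" for w
  have a0: "(a \<longlongrightarrow> 0) (at z within S)"
    using A z unfolding continuous_on_def a_def
    by (simp add: tendsto_norm_zero LIM_zero)
  have eq: "T w - T z = - (T w o\<^sub>L ((A w - A z) o\<^sub>L T z))" if "w \<in> S" for w
  proof (rule blinfun_eqI)
    fix v
    have "T w (A w (T z v)) = T z v" "A z (T z v) = v"
      using TA[OF that] AT[OF z] by (metis blinfun_apply_blinfun_compose blinfun_apply_id_blinfun)+
    then show "(T w - T z) v = (- (T w o\<^sub>L ((A w - A z) o\<^sub>L T z))) v"
      by (simp add: blinfun.bilinear_simps)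
  qed
  have le: "norm (T w - T z) \<le> norm (T w) * (a w * norm (T z))" if "w \<in> S" for w
    unfolding eq[OF that] a_def norm_minus_cancel
    by (rule order_trans[OF norm_blinfun_compose])
      (intro mult_left_mono norm_blinfun_compose norm_ge_zero)
  have "eventually (\<lambda>w. a w < 1 / (2 * (norm (T z) + 1))) (at z within S)"
    by (rule order_tendstoD[OF a0]) (simp add: add_nonneg_pos)
  moreover have "eventually (\<lambda>w. w \<in> S) (at z within S)"
    by (simp add: eventually_at_topological) (metis open_UNIV UNIV_I)
  ultimately have "eventually (\<lambda>w. norm (T w - T z) \<le> 2 * norm (T z) * norm (T z) * a w) (at z within S)"
  proof eventually_elim
    case (elim w)
    have a: "0 \<le> a w" unfolding a_def by simp
    have "a w * norm (T z) \<le> 1 / (2 * (norm (T z) + 1)) * norm (T z)"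
      using elim by (intro mult_right_mono) auto
    also have "\<dots> \<le> 1 / 2"
      by (simp add: divide_simps) (use norm_ge_zero[of "T z"] in linarith)
    finally have "norm (T w) * (a w * norm (T z)) \<le> norm (T w) * (1/2)"
      by (intro mult_left_mono) auto
    moreover have "norm (T w) \<le> norm (T z) + norm (T w - T z)"
      using norm_triangle_sub by blast
    ultimately have "norm (T w) \<le> 2 * norm (T z)"
      using le[OF elim(2)] by linarith
    then have "norm (T w) * (a w * norm (T z)) \<le> 2 * norm (T z) * (a w * norm (T z))"
      using a by (intro mult_right_mono) auto
    then show ?case using le[OF elim(2)] by (simp add: algebra_simps)
  qed
  moreover have "((\<lambda>w. 2 * norm (T z) * norm (T z) * a w) \<longlongrightarrow> 0) (at z within S)"
    using tendsto_mult_right_zero[OF a0] .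
  ultimately have "((\<lambda>w. T w - T z) \<longlongrightarrow> 0) (at z within S)"
    by (rule Lim_null_comparison)
  then show "(T \<longlongrightarrow> T z) (at z within S)"
    by (rule LIM_zero_cancel)
qed

text \<open>Near the point the first factor is at most of first order and the second one tends to zero, so the
  product is of smaller than first order.\<close>

lemma has_derivative_compose_zero:
  fixes f :: "'a::real_normed_vector \<Rightarrow> 'c::real_normed_vector \<Rightarrow>\<^sub>L 'd::real_normed_vector"
    and g :: "'a \<Rightarrow> 'b::real_normed_vector \<Rightarrow>\<^sub>L 'c"
  assumes f: "(f has_derivative f') (at z within S)" and f0: "f z = 0"
    and g: "(g \<longlongrightarrow> 0) (at z within S)" and g0: "g z = 0"
  shows "((\<lambda>w. f w o\<^sub>L g w) has_derivative (\<lambda>h. 0)) (at z within S)"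
  unfolding has_derivative_within_alt
proof (intro conjI allI impI)
  show "bounded_linear (\<lambda>h. 0)" by (rule bounded_linear_zero)
  fix e :: real assume e: "0 < e"
  obtain B where B: "0 \<le> B" "\<And>h. norm (f' h) \<le> norm h * B"
    using has_derivative_bounded_linear[OF f] bounded_linear.nonneg_bounded by blast
  obtain d where d: "d > 0" "\<And>y. y \<in> S \<Longrightarrow> norm (y - z) < d \<Longrightarrow> norm (f y - f z - f' (y - z)) \<le> 1 * norm (y - z)"
    using f unfolding has_derivative_within_alt by (meson zero_less_one)
  have "e / (B + 1) > 0" using e B by simp
  then obtain d' where d': "d' > 0" "\<And>y. y \<in> S \<Longrightarrow> y \<noteq> z \<Longrightarrow> norm (y - z) < d' \<Longrightarrow> norm (g y) < e / (B + 1)"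
    using g unfolding Lim_within dist_norm by (metis diff_zero zero_less_norm_iff right_minus_eq)
  show "\<exists>d>0. \<forall>y\<in>S. norm (y - z) < d \<longrightarrow> norm ((f y o\<^sub>L g y) - (f z o\<^sub>L g z) - 0) \<le> e * norm (y - z)"
  proof (intro exI[of _ "min d d'"] conjI ballI impI)
    show "0 < min d d'" using d d' by simp
    fix y assume y: "y \<in> S" "norm (y - z) < min d d'"
    show "norm ((f y o\<^sub>L g y) - (f z o\<^sub>L g z) - 0) \<le> e * norm (y - z)"
    proof (cases "y = z")
      case False
      have "norm (f y) \<le> norm (f y - f z - f' (y - z)) + norm (f' (y - z))"
        using norm_triangle_sub[of "f y" "f' (y - z)"] f0 by simp
      also have "\<dots> \<le> norm (y - z) * (B + 1)"
        using d(2)[OF y(1)] B(2)[of "y - z"] y(2) by (simp add: algebra_simps)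
      finally have "norm (f y) * norm (g y) \<le> norm (y - z) * (B + 1) * (e / (B + 1))"
        using d'(2)[OF y(1) False] y(2) B(1) by (intro mult_mono) auto
      also have "\<dots> = e * norm (y - z)" using B(1) by simp
      finally show ?thesis
        using norm_blinfun_compose[of "f y" "g y"] f0 by simp
    qed (use f0 g0 in simp)
  qed
qed

text \<open>Expanding \<open>T w = T z - T z (A w - A z) T z - T z (A w - A z) (T w - T z)\<close>, the last term is of
  smaller than first order because \<open>T\<close> is continuous, so the derivative of \<open>T\<close> at \<open>z\<close> is \<open>h \<mapsto> - T z (A' z h) (T z)\<close>.\<close>

lemma C1_on_blinfun_inverse:
  fixes A :: "'a::real_normed_vector \<Rightarrow> 'b::real_normed_vector \<Rightarrow>\<^sub>L 'c::real_normed_vector"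
  assumes A: "C1_on S A"
    and TA: "\<And>x. x \<in> S \<Longrightarrow> T x o\<^sub>L A x = id_blinfun"
    and AT: "\<And>x. x \<in> S \<Longrightarrow> A x o\<^sub>L T x = id_blinfun"
  shows "C1_on S T"
proof -
  have T: "continuous_on S T"
    using continuous_on_blinfun_inverse[OF C1_on_imp_continuous_on[OF A] TA AT] .
  obtain A' where A': "\<And>x. x \<in> S \<Longrightarrow> (A has_derivative blinfun_apply (A' x)) (at x within S)"
    "continuous_on S A'" using A by (rule C1_on_derivative) blast
  interpret r: bounded_bilinear "(o\<^sub>L) :: ('c \<Rightarrow>\<^sub>L 'b) \<Rightarrow> ('c \<Rightarrow>\<^sub>L 'c) \<Rightarrow> ('c \<Rightarrow>\<^sub>L 'b)"
    by (rule bounded_bilinear_blinfun_compose)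
  interpret l: bounded_bilinear "(o\<^sub>L) :: ('b \<Rightarrow>\<^sub>L 'c) \<Rightarrow> ('c \<Rightarrow>\<^sub>L 'b) \<Rightarrow> ('c \<Rightarrow>\<^sub>L 'c)"
    by (rule bounded_bilinear_blinfun_compose)
  define D where "D z = - ((r.prod_right (T z) o\<^sub>L l.prod_left (T z)) o\<^sub>L A' z)" for z
  have "continuous_on S D"
    unfolding D_def
    by (intro continuous_intros A'(2) bounded_linear.continuous_on[OF r.bounded_linear_prod_right]
        bounded_linear.continuous_on[OF l.bounded_linear_prod_left] T)
  moreover have "(T has_derivative D z) (at z within S)" if z: "z \<in> S" for z
  proof -
    define U where "U w = T z o\<^sub>L (A w - A z)" for w
    have "((\<lambda>w. r.prod_right (T z) (l.prod_left (T z) (A w)) ) has_derivative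
        (\<lambda>h. r.prod_right (T z) (l.prod_left (T z) (A' z h)))) (at z within S)"
      by (intro bounded_linear.has_derivative[OF blinfun.bounded_linear_right] A'(1) z)
    then have 1: "((\<lambda>w. T z o\<^sub>L (A w o\<^sub>L T z)) has_derivative (\<lambda>h. T z o\<^sub>L (A' z h o\<^sub>L T z))) (at z within S)"
      by simp
    have "((\<lambda>w. T z o\<^sub>L (A w - A z)) has_derivative (\<lambda>h. T z o\<^sub>L (A' z h - 0))) (at z within S)"
      by (intro bounded_linear.has_derivative[OF
            bounded_bilinear.bounded_linear_right[OF bounded_bilinear_blinfun_compose]]
          has_derivative_diff A'(1) z has_derivative_const)
    moreover have "((\<lambda>w. T w - T z) \<longlongrightarrow> 0) (at z within S)"
      using T z unfolding continuous_on_def by (simp add: LIM_zero)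
    ultimately have 2: "((\<lambda>w. (T z o\<^sub>L (A w - A z)) o\<^sub>L (T w - T z)) has_derivative (\<lambda>h. 0)) (at z within S)"
      by (intro has_derivative_compose_zero[where f'="\<lambda>h. T z o\<^sub>L (A' z h - 0)"]) auto
    have "((\<lambda>w. (T z + T z) - (T z o\<^sub>L (A w o\<^sub>L T z)) - ((T z o\<^sub>L (A w - A z)) o\<^sub>L (T w - T z)))
        has_derivative (\<lambda>h. 0 - (T z o\<^sub>L (A' z h o\<^sub>L T z)) - 0)) (at z within S)"
      by (intro has_derivative_diff 1 2 has_derivative_const)
    moreover have "(\<lambda>h. 0 - (T z o\<^sub>L (A' z h o\<^sub>L T z)) - 0) = blinfun_apply (D z)"
      by (rule ext) (simp add: D_def blinfun.bilinear_simps)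
    moreover have "T w = (T z + T z) - (T z o\<^sub>L (A w o\<^sub>L T z)) - ((T z o\<^sub>L (A w - A z)) o\<^sub>L (T w - T z))"
      if w: "w \<in> S" for w
    proof (rule blinfun_eqI)
      fix v
      have inv: "T z (A z x) = x" "A w (T w y) = y" "A z (T z y) = y" for x y
        using TA[OF z] AT[OF w] AT[OF z]
        by (metis blinfun_apply_blinfun_compose blinfun_apply_id_blinfun)+
      show "T w v = ((T z + T z) - (T z o\<^sub>L (A w o\<^sub>L T z)) - ((T z o\<^sub>L (A w - A z)) o\<^sub>L (T w - T z))) v"
        by (simp add: blinfun.bilinear_simps inv)
    qed
    ultimately show ?thesis
      using has_derivative_transform[OF z, of T "\<lambda>w. (T z + T z) - (T z o\<^sub>L (A w o\<^sub>L T z)) - ((T z o\<^sub>L (A w - A z)) o\<^sub>L (T w - T z))"]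
      by simp
  qed
  ultimately show ?thesis
    by (intro C1_onI[where f'=D])
qed

text \<open>The derivative of the inverse map inverts the derivative, so the inverse inherits the
  differentiability class.\<close>

lemma C2_inverse_function:
  fixes f :: "'a::euclidean_space \<Rightarrow> 'a"
  assumes "open U" and f: "C2_on U f" and x0: "x0 \<in> U"
    and D: "(f has_derivative D) (at x0)" and "inj D"
  obtains U' V g where "open U'" "U' \<subseteq> U" "x0 \<in> U'" "open V" "f x0 \<in> V" "homeomorphism U' V f g" "C2_on V g"
proof -
  obtain f' where f': "\<And>x. x \<in> U \<Longrightarrow> (f has_derivative blinfun_apply (f' x)) (at x within U)"
    "C1_on U f'" using f by (rule C2_on_derivative) blast
  have der: "(f has_derivative blinfun_apply (f' x)) (at x)" if "x \<in> U" for x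
    using f'(1)[OF that] at_within_open[OF that \<open>open U\<close>] by simp
  have D': "D = blinfun_apply (f' x0)"
    using has_derivative_unique[OF D der[OF x0]] .
  obtain L where L: "linear L" "L \<circ> D = id"
    using linear_injective_left_inverse[of D] D \<open>inj D\<close> has_derivative_linear by blast
  have "Blinfun L o\<^sub>L f' x0 = id_blinfun"
    using L by (intro blinfun_eqI)
      (simp add: bounded_linear_Blinfun_apply linear_conv_bounded_linear D' fun_eq_iff)
  then obtain U' V g g' where g: "open U'" "U' \<subseteq> U" "x0 \<in> U'" "open V" "f x0 \<in> V"
      and hom: "homeomorphism U' V f g"
      and g': "\<And>y. y \<in> V \<Longrightarrow> (g has_derivative (g' y)) (at y)"
        "\<And>y. y \<in> V \<Longrightarrow> g' y = inv (blinfun_apply (f'(g y)))"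
        "\<And>y. y \<in> V \<Longrightarrow> bij (blinfun_apply (f'(g y)))"
    using inverse_function_theorem[OF \<open>open U\<close> der C1_on_imp_continuous_on[OF f'(2)] x0] by metis
  have gU: "g ` V \<subseteq> U" using hom g(2) unfolding homeomorphism_def by blast
  define T where "T y = Blinfun (g' y)" for y
  have T: "blinfun_apply (T y) = inv (blinfun_apply (f'(g y)))" if "y \<in> V" for y
    unfolding T_def using bounded_linear_Blinfun_apply has_derivative_bounded_linear g'(1,2) that by metis
  have TA: "T y o\<^sub>L f' (g y) = id_blinfun" "f' (g y) o\<^sub>L T y = id_blinfun" if "y \<in> V" for y
    using g'(3)[OF that] by (auto intro!: blinfun_eqI simp: T[OF that] bij_is_inj bij_is_surj surj_f_inv_f)
  have gT: "(g has_derivative T y) (at y within V)" if "y \<in> V" for y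
    using T g' that by (simp add: has_derivative_at_withinI)
  have "continuous_on V g" using hom unfolding homeomorphism_def by blast
  then have "continuous_on V (\<lambda>y. f' (g y))"
    by (rule continuous_on_compose2[OF C1_on_imp_continuous_on[OF f'(2)] _ gU])
  then have "continuous_on V T"
    by (rule continuous_on_blinfun_inverse) (use TA in auto)
  with gT have "C1_on V g" by (rule C1_onI)
  then have "C1_on V (\<lambda>y. f' (g y))"
    by (rule C1_on_compose[OF f'(2) _ gU])
  then have "C1_on V T"
    by (rule C1_on_blinfun_inverse) (use TA in auto)
  with gT have "C2_on V g" by (rule C2_onI)
  with g hom that show ?thesis by blast
qed

section \<open>Gluing prescribed values and derivatives\<close>

lemma has_vector_derivative_max_power:
  assumes "0 < n"
  shows "((\<lambda>t::real. max 0 t ^ Suc n) has_vector_derivative (real (Suc n) * max 0 t ^ n)) (at t)"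
proof -
  consider "t > 0" | "t < 0" | "t = 0" by linarith
  then have "((\<lambda>t::real. max 0 t ^ Suc n) has_real_derivative (real (Suc n) * max 0 t ^ n)) (at t)"
  proof cases
    case 1
    have "((\<lambda>t::real. t ^ Suc n) has_real_derivative real (Suc n) * t ^ n) (at t)"
      by (use DERIV_pow[of "Suc n" t UNIV] in \<open>simp del: power_Suc of_nat_Suc\<close>)
    then have "((\<lambda>t::real. max 0 t ^ Suc n) has_real_derivative real (Suc n) * t ^ n) (at t)"
      by (rule has_field_derivative_transform_within_open[where S="{0<..}"]) (use 1 in auto)
    then show ?thesis using 1 by simp
  next
    case 2
    have "((\<lambda>t::real. 0) has_real_derivative 0) (at t)" by simp
    then have "((\<lambda>t::real. max 0 t ^ Suc n) has_real_derivative 0) (at t)"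
      by (rule has_field_derivative_transform_within_open[where S="{..<0}"]) (use 2 in auto)
    moreover have "real (Suc n) * max 0 t ^ n = 0" using 2 assms by simp
    ultimately show ?thesis by metis
  next
    case 3
    have "((\<lambda>h::real. max 0 h ^ n) \<longlongrightarrow> max 0 0 ^ n) (at 0)"
      by (intro tendsto_intros)
    moreover have "max 0 (0::real) ^ n = 0" using assms by simp
    ultimately have "((\<lambda>h::real. max 0 h ^ n) \<longlongrightarrow> 0) (at 0)" by metis
    moreover have "max 0 h ^ n = (max 0 (0 + h) ^ Suc n - max 0 0 ^ Suc n) / h" if "h \<noteq> 0" for h :: real
      using that assms by (auto simp: max_def)
    then have "eventually (\<lambda>h. max 0 h ^ n = (max 0 (0 + h) ^ Suc n - max 0 0 ^ Suc n) / h) (at (0::real))"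
      by (auto simp: eventually_at_filter)
    ultimately have "((\<lambda>h::real. (max 0 (0 + h) ^ Suc n - max 0 0 ^ Suc n) / h) \<longlongrightarrow> 0) (at 0)"
      by (rule Lim_transform_eventually)
    moreover have "real (Suc n) * max 0 t ^ n = 0" using 3 assms by simp
    ultimately show ?thesis
      unfolding 3 DERIV_def by metis
  qed
  then show ?thesis by (simp add: has_real_derivative_iff_has_vector_derivative)
qed

lemma C2_on_max_cube: "C2_on S (\<lambda>t::real. max 0 t ^ 3)"
proof -
  have sq: "((\<lambda>t::real. max 0 t ^ 2) has_vector_derivative (2 * max 0 t)) (at t)" for t
    using has_vector_derivative_max_power[of 1 t] by (simp add: numeral_2_eq_2)
  have cube: "((\<lambda>t::real. max 0 t ^ 3) has_vector_derivative 3 *\<^sub>R (max 0 t ^ 2)) (at t)" for t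
    using has_vector_derivative_max_power[of 2 t] by (simp add: numeral_3_eq_3 numeral_2_eq_2)
  have "C1_on UNIV (\<lambda>t::real. max 0 t ^ 2)"
    by (rule C1_on_vector_derivative[OF sq]) (intro continuous_intros)
  then have "C2_on UNIV (\<lambda>t::real. max 0 t ^ 3)"
    by (intro C2_on_vector_derivative[OF cube] C1_on_linear_image[OF bounded_linear_scaleR_right])
  then show ?thesis by (rule C2_on_subset) simp
qed

text \<open>With \<open>w t = (max 0 t)\<^sup>3\<close>, the function \<open>1 - w (1 - 8 w (1 - q))\<close> of \<open>q\<close> is
  \<open>1\<close> for \<open>q \<le> 1/2\<close> and \<open>0\<close> for \<open>q \<ge> 1\<close>.\<close>

lemma C2_bump_function:
  fixes p :: "'a::real_inner"
  assumes "0 < r"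
  obtains \<psi> :: "'a \<Rightarrow> real" where "C2_on UNIV \<psi>"
    "\<And>y. y \<in> ball p (r/2) \<Longrightarrow> \<psi> y = 1" "\<And>y. y \<notin> ball p r \<Longrightarrow> \<psi> y = 0"
proof -
  define w where "w t = max 0 t ^ 3" for t :: real
  define q where "q y = (y - p) \<bullet> (y - p) * (1 / r\<^sup>2)" for y
  define \<psi> where "\<psi> y = 1 - w (1 - 8 * w (1 - q y))" for y
  have w: "C2_on UNIV (\<lambda>y. w (f y))" if "C2_on UNIV f" for f :: "'a \<Rightarrow> real"
    unfolding w_def by (rule C2_on_compose[OF C2_on_max_cube[of UNIV] that]) simp
  have "C2_on UNIV q"
    unfolding q_def by (intro C2_on_mult C2_on_inner C2_on_diff C2_on_const C2_on_ident)
  then have 1: "C2_on UNIV \<psi>"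
    unfolding \<psi>_def by (intro C2_on_diff C2_on_const C2_on_mult w)
  have q: "q y = (dist p y / r)\<^sup>2" for y
    by (simp add: q_def dist_norm power2_norm_eq_inner norm_minus_commute[of p] power_divide)
  have 2: "\<psi> y = 1" if "y \<in> ball p (r/2)" for y
  proof -
    have "dist p y / r \<le> 1/2" using that assms by (simp add: field_simps)
    then have "q y \<le> (1/2)\<^sup>2" unfolding q using assms by (intro power_mono) auto
    then have "1/2 \<le> 1 - q y" by (simp add: power2_eq_square)
    then have "(1/2)^3 \<le> w (1 - q y)" unfolding w_def by (intro power_mono) auto
    then have "1 - 8 * w (1 - q y) \<le> 0" by (simp add: power3_eq_cube)
    then have "w (1 - 8 * w (1 - q y)) = 0" unfolding w_def[of "1 - _"] by simp
    then show ?thesis by (simp add: \<psi>_def)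
  qed
  have 3: "\<psi> y = 0" if "y \<notin> ball p r" for y
  proof -
    have "1 \<le> dist p y / r" using that assms by (simp add: field_simps)
    then have "1 \<le> q y" unfolding q by (simp add: one_le_power)
    then show ?thesis by (simp add: \<psi>_def w_def)
  qed
  show thesis using that 1 2 3 by blast
qed

text \<open>Prescribing values \<open>F\<close> and derivatives \<open>T\<close> on a set \<open>K\<close> is a local problem: in a
  convex combination of local solutions the derivatives of the weights are multiplied by values that
  agree on \<open>K\<close>. The weights are \<open>R\<^sub>k \<psi>\<^sub>k\<close> with \<open>R\<^sub>k = (1 - \<psi>\<^sub>0) \<dots> (1 - \<psi>\<^sub>k\<^sub>-\<^sub>1)\<close>, which vanish for
  \<open>k > j\<close> wherever \<open>\<psi>\<^sub>j\<close> is \<open>1\<close>. As this happens on an open ball \<open>B\<^sub>j\<close> for each \<open>j\<close> and these balls cover \<open>K\<close>, the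
  sum is locally finite.\<close>

lemma C2_glue_prescribed_derivatives:
  fixes K :: "'a::euclidean_space set" and F :: "'a \<Rightarrow> 'b::real_normed_vector"
    and T :: "'a \<Rightarrow> 'a \<Rightarrow> 'b"
  assumes loc: "\<And>y. y \<in> K \<Longrightarrow> \<exists>W \<xi>. open W \<and> y \<in> W \<and> C2_on W \<xi> \<and>
      (\<forall>z\<in>K \<inter> W. \<xi> z = F z \<and> (\<xi> has_derivative T z) (at z))"
  obtains W \<xi> where "open W" "K \<subseteq> W" "C2_on W \<xi>"
    "\<And>z. z \<in> K \<Longrightarrow> \<xi> z = F z" "\<And>z. z \<in> K \<Longrightarrow> (\<xi> has_derivative T z) (at z)"
proof (cases "K = {}")
  case True
  show ?thesis by (rule that[of "{}" "\<lambda>_. 0"]) (use True in \<open>auto intro: C2_on_const\<close>)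
next
  case False
  \<comment> \<open>The local solutions live on balls of radius \<open>2 r\<close> while the bump functions vanish outside radius \<open>r\<close>, so
    that their products extend by zero.\<close>
  define Q where "Q y r \<xi> \<longleftrightarrow> 0 < r \<and> C2_on (ball y (2 * r)) \<xi> \<and>
      (\<forall>z\<in>K \<inter> ball y (2 * r). \<xi> z = F z \<and> (\<xi> has_derivative T z) (at z))" for y r \<xi>
  have "\<exists>r \<xi>. Q y r \<xi>" if y: "y \<in> K" for y
  proof -
    obtain W \<xi> where W: "open W" "y \<in> W" "C2_on W \<xi>"
      "\<forall>z\<in>K \<inter> W. \<xi> z = F z \<and> (\<xi> has_derivative T z) (at z)" using loc[OF y] by blast
    obtain r where r: "0 < r" "ball y r \<subseteq> W" using W openE by blast
    have "C2_on (ball y r) \<xi>" using C2_on_subset W(3) r(2) by blast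
    then have "Q y (r/2) \<xi>" unfolding Q_def using W(4) r by auto
    then show ?thesis by blast
  qed
  then obtain r \<xi> where Q: "\<And>y. y \<in> K \<Longrightarrow> Q y (r y) (\<xi> y)" by metis
  have r: "\<And>y. y \<in> K \<Longrightarrow> 0 < r y"
    and C2: "\<And>y. y \<in> K \<Longrightarrow> C2_on (ball y (2 * r y)) (\<xi> y)"
    and F: "\<And>y z. y \<in> K \<Longrightarrow> z \<in> K \<Longrightarrow> z \<in> ball y (2 * r y) \<Longrightarrow> \<xi> y z = F z"
    and T: "\<And>y z. y \<in> K \<Longrightarrow> z \<in> K \<Longrightarrow> z \<in> ball y (2 * r y) \<Longrightarrow> (\<xi> y has_derivative T z) (at z)"
    using Q unfolding Q_def by blast+
  obtain \<F> where \<F>: "\<F> \<subseteq> (\<lambda>y. ball y (r y / 2)) ` K" "countable \<F>"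
    "\<Union>\<F> = \<Union> ((\<lambda>y. ball y (r y / 2)) ` K)"
    using Lindelof[of "(\<lambda>y. ball y (r y / 2)) ` K"] by auto
  define W where "W = \<Union>\<F>"
  have "open W" unfolding W_def using \<F>(1) by (intro open_Union) auto
  have KW: "K \<subseteq> W" unfolding W_def \<F>(3) using r by fastforce
  then have "\<F> \<noteq> {}" using False unfolding W_def by auto
  then obtain B :: "nat \<Rightarrow> 'a set" where B: "range B = \<F>" using \<F>(2) uncountable_def by metis
  have "\<exists>y\<in>K. B k = ball y (r y / 2)" for k
  proof -
    have "B k \<in> \<F>" using B by blast
    then show ?thesis using \<F>(1) by blast
  qed
  then obtain p where p: "\<And>k. p k \<in> K" "\<And>k. B k = ball (p k) (r (p k) / 2)" by metis
  define good where "good k \<psi> \<longleftrightarrow> C2_on UNIV \<psi> \<and> (\<forall>y\<in>B k. \<psi> y = 1) \<and> (\<forall>y. y \<notin> ball (p k) (r (p k)) \<longrightarrow> \<psi> y = 0)"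
    for k and \<psi> :: "'a \<Rightarrow> real"
  have "\<exists>\<psi>. good k \<psi>" for k
    by (rule C2_bump_function[OF r[OF p(1)[of k]], where p="p k"]) (auto simp: good_def p(2))
  then obtain \<psi> where "\<And>k. good k (\<psi> k)" by metis
  then have \<psi>: "\<And>k. C2_on UNIV (\<psi> k)" "\<And>k y. y \<in> B k \<Longrightarrow> \<psi> k y = 1"
    "\<And>k y. y \<notin> ball (p k) (r (p k)) \<Longrightarrow> \<psi> k y = 0"
    unfolding good_def by blast+
  define \<eta> where "\<eta> k y = \<psi> k y *\<^sub>R \<xi> (p k) y" for k y
  have out: "\<exists>O'. open O' \<and> y \<in> O' \<and> (\<forall>z\<in>O'. \<psi> k z = 0)" if "y \<notin> ball (p k) (2 * r (p k))" for k y
  proof (intro exI[of _ "- cball (p k) (r (p k))"] conjI ballI)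
    show "y \<in> - cball (p k) (r (p k))" using that r[OF p(1), of k] by auto
    show "\<psi> k z = 0" if "z \<in> - cball (p k) (r (p k))" for z using that by (intro \<psi>(3)) auto
  qed auto
  have C2\<eta>: "C2_on UNIV (\<eta> k)" for k
  proof (rule C2_on_locally)
    fix y
    show "\<exists>W. open W \<and> y \<in> W \<and> C2_on W (\<eta> k)"
    proof (cases "y \<in> ball (p k) (2 * r (p k))")
      case True
      have "C2_on (ball (p k) (2 * r (p k))) (\<eta> k)"
        unfolding \<eta>_def by (intro C2_on_scaleR C2[OF p(1)] C2_on_subset[OF \<psi>(1)]) simp
      then show ?thesis using True by blast
    next
      case False
      then obtain O' where "open O'" "y \<in> O'" "\<forall>z\<in>O'. \<psi> k z = 0" using out by blast
      moreover then have "C2_on O' (\<eta> k)"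
        using C2_on_cong[of O' "\<eta> k" "\<lambda>_. 0"] C2_on_const[of O' 0] by (simp add: \<eta>_def)
      ultimately show ?thesis by blast
    qed
  qed
  define R where "R = rec_nat (\<lambda>_. 1) (\<lambda>k f y. f y * (1 - \<psi> k y))"
  define \<Xi> where "\<Xi> = rec_nat (\<lambda>_. 0) (\<lambda>k f y. f y + R k y *\<^sub>R \<eta> k y)"
  have R: "R 0 = (\<lambda>_. 1)" "\<And>k. R (Suc k) = (\<lambda>y. R k y * (1 - \<psi> k y))"
    and \<Xi>: "\<Xi> 0 = (\<lambda>_. 0)" "\<And>k. \<Xi> (Suc k) = (\<lambda>y. \<Xi> k y + R k y *\<^sub>R \<eta> k y)"
    unfolding R_def \<Xi>_def by simp_all
  have C2R: "C2_on UNIV (R k)" for k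
    by (induction k) (auto simp: R intro!: C2_on_const C2_on_mult C2_on_diff \<psi>(1))
  have C2\<Xi>: "C2_on UNIV (\<Xi> k)" for k
    by (induction k) (auto simp: \<Xi> intro!: C2_on_const C2_on_add C2_on_scaleR C2R C2\<eta>)
  \<comment> \<open>Adding the leftover weight times the constant \<open>F z\<close> keeps the value \<open>F z\<close> throughout, so that
    the derivatives of the weights cancel in every step.\<close>
  have inv: "\<Xi> k z + R k z *\<^sub>R F z = F z \<and>
      ((\<lambda>y. \<Xi> k y + R k y *\<^sub>R F z) has_derivative (\<lambda>h. (1 - R k z) *\<^sub>R T z h)) (at z)"
    if z: "z \<in> K" for k z
  proof (induction k)
    case 0
    then show ?case by (simp add: R \<Xi>)
  next
    case (Suc k)
    have eq: "\<Xi> (Suc k) y + R (Suc k) y *\<^sub>R F z =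
        (\<Xi> k y + R k y *\<^sub>R F z) + (R k y * \<psi> k y) *\<^sub>R (\<xi> (p k) y - F z)" for y
      by (simp add: R \<Xi> \<eta>_def algebra_simps)
    have step: "(R k z * \<psi> k z) *\<^sub>R (\<xi> (p k) z - F z) = 0 \<and>
      ((\<lambda>y. (R k y * \<psi> k y) *\<^sub>R (\<xi> (p k) y - F z)) has_derivative (\<lambda>h. (R k z * \<psi> k z) *\<^sub>R T z h)) (at z)"
    proof (cases "z \<in> ball (p k) (2 * r (p k))")
      case True
      have F': "\<xi> (p k) z = F z" and T': "(\<xi> (p k) has_derivative T z) (at z)"
        using F[OF p(1) z True] T[OF p(1) z True] by auto
      have "C2_on UNIV (\<lambda>y. R k y * \<psi> k y)" by (intro C2_on_mult C2R \<psi>(1))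
      then obtain D where "((\<lambda>y. R k y * \<psi> k y) has_derivative blinfun_apply (D z)) (at z)"
        by (rule C2_on_derivative) (metis UNIV_I)
      from has_derivative_scaleR[OF this has_derivative_diff[OF T' has_derivative_const[of "F z"]]]
      show ?thesis by (simp add: F')
    next
      case False
      then obtain O' where O': "open O'" "z \<in> O'" "\<forall>z\<in>O'. \<psi> k z = 0" using out by blast
      have "((\<lambda>y. (R k y * \<psi> k y) *\<^sub>R (\<xi> (p k) y - F z)) has_derivative (\<lambda>h. 0)) (at z)"
        by (rule has_derivative_transform_within_open[OF has_derivative_const[of 0] O'(1,2)])
          (use O'(3) in simp)
      then show ?thesis using O' by simp
    qed
    have "((\<lambda>y. (\<Xi> k y + R k y *\<^sub>R F z) + (R k y * \<psi> k y) *\<^sub>R (\<xi> (p k) y - F z)) has_derivative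
        (\<lambda>h. (1 - R k z) *\<^sub>R T z h + (R k z * \<psi> k z) *\<^sub>R T z h)) (at z)"
      using has_derivative_add[OF conjunct2[OF Suc.IH] conjunct2[OF step]] .
    moreover have "(\<lambda>h. (1 - R k z) *\<^sub>R T z h + (R k z * \<psi> k z) *\<^sub>R T z h) = (\<lambda>h. (1 - R (Suc k) z) *\<^sub>R T z h)"
      by (simp add: R algebra_simps)
    ultimately show ?case
      unfolding eq using conjunct1[OF Suc.IH] conjunct1[OF step] by simp
  qed
  have R0: "R (Suc j + i) y = 0" if "y \<in> B j" for i j y
    by (induction i) (use that \<psi>(2) in \<open>auto simp: R\<close>)
  have const: "\<Xi> (Suc j + i) y = \<Xi> (Suc j) y" if "y \<in> B j" for i j y
    by (induction i) (use R0[OF that] in \<open>auto simp: \<Xi>(2)\<close>)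
  define J where "J y = (LEAST j. y \<in> B j)" for y
  define \<zeta> where "\<zeta> y = \<Xi> (Suc (J y)) y" for y
  have \<zeta>: "\<zeta> y = \<Xi> (Suc j) y" if "y \<in> B j" for j y
  proof -
    have "y \<in> B (J y)" "J y \<le> j" unfolding J_def using that by (auto intro: LeastI Least_le)
    then show ?thesis using const[of y "J y" "j - J y"] by (simp add: \<zeta>_def)
  qed
  have opB: "open (B j)" for j by (simp add: p(2))
  have "C2_on W \<zeta>"
  proof (rule C2_on_locally)
    fix y assume "y \<in> W"
    then obtain j where j: "y \<in> B j" unfolding W_def using B by auto
    have "C2_on (B j) \<zeta>"
      using C2_on_cong[of "B j" \<zeta> "\<Xi> (Suc j)"] \<zeta> C2_on_subset[OF C2\<Xi>] by blast
    then show "\<exists>W. open W \<and> y \<in> W \<and> C2_on W \<zeta>" using j opB by blast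
  qed
  moreover have "\<zeta> z = F z \<and> (\<zeta> has_derivative T z) (at z)" if z: "z \<in> K" for z
  proof -
    obtain j where j: "z \<in> B j" using z KW B unfolding W_def by auto
    have R: "R (Suc j) y = 0" if "y \<in> B j" for y using R0[OF that, of 0] by simp
    have "((\<lambda>y. \<Xi> (Suc j) y + R (Suc j) y *\<^sub>R F z) has_derivative T z) (at z)"
      using inv[OF z, of "Suc j"] R[OF j] by simp
    then have "(\<zeta> has_derivative T z) (at z)"
      by (rule has_derivative_transform_within_open[OF _ opB j]) (simp add: R \<zeta>)
    then show ?thesis using inv[OF z, of "Suc j"] R[OF j] \<zeta>[OF j] by simp
  qed
  ultimately show ?thesis using that \<open>open W\<close> KW by blast
qed

section \<open>Primitives and extensions on the real line\<close>

text \<open>Primitives and extensions are built on compact intervals, while the parameter sets may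
  be half-open or unbounded; a compact subinterval with the same germ at the given point mediates between
  the two. It also contains a chosen base point, from which integrals are taken.\<close>

lemma interval_local_Icc:
  fixes K :: "real set"
  assumes K: "is_interval K" and s: "s \<in> K" and a: "a \<in> K"
  obtains p q where "{p..q} \<subseteq> K" "s \<in> {p..q}" "a \<in> {p..q}" "at s within K = at s within {p..q}"
    "eventually (\<lambda>t. t \<in> K \<longrightarrow> t \<in> {p..q}) (nhds s)"
proof -
  obtain p where p: "p \<in> K" "p \<le> s" "p \<le> a" "\<forall>t\<in>K. t < s \<longrightarrow> p < s"
  proof (cases "\<exists>t\<in>K. t < s")
    case True
    then obtain t where "t \<in> K" "t < s" by blast
    then show ?thesis using that[of "min t a"] a by (auto simp: min_def)
  next
    case False
    then show ?thesis using that[of s] s a by (metis leI order_refl)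
  qed
  obtain q where q: "q \<in> K" "s \<le> q" "a \<le> q" "\<forall>t\<in>K. s < t \<longrightarrow> s < q"
  proof (cases "\<exists>t\<in>K. s < t")
    case True
    then obtain t where "t \<in> K" "s < t" by blast
    then show ?thesis using that[of "max t a"] a by (auto simp: max_def)
  next
    case False
    then show ?thesis using that[of s] s a by (metis leI order_refl)
  qed
  define O' where "O' = (if p < s then {p<..} else UNIV) \<inter> (if s < q then {..<q} else UNIV)"
  have O': "open O'" "s \<in> O'" unfolding O'_def by auto
  have sub: "{p..q} \<subseteq> K"
    using K p(1) q(1) unfolding is_interval_1 by (meson atLeastAtMost_iff subsetI)
  have in': "t \<in> {p..q}" if "t \<in> K" "t \<in> O'" for t
    using that p q unfolding O'_def by (cases t s rule: linorder_cases) (auto split: if_splits)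
  show thesis
  proof (rule that[OF sub])
    show "at s within K = at s within {p..q}"
      by (rule at_within_nhd[OF O'(2,1)]) (use sub in' in blast)
    show "eventually (\<lambda>t. t \<in> K \<longrightarrow> t \<in> {p..q}) (nhds s)"
      using O' in' unfolding eventually_nhds by blast
  qed (use p q in auto)
qed

text \<open>The oriented integral, so that the base point may be any point of the interval.\<close>

definition primitive_from :: "real \<Rightarrow> (real \<Rightarrow> 'b::banach) \<Rightarrow> real \<Rightarrow> 'b" where
  "primitive_from a \<beta> s = (if a \<le> s then integral {a..s} \<beta> else - integral {s..a} \<beta>)"

lemma primitive_from_has_vector_derivative:
  assumes "is_interval K" "a \<in> K" "s \<in> K" and \<beta>: "continuous_on K \<beta>"
  shows "(primitive_from a \<beta> has_vector_derivative \<beta> s) (at s within K)"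
proof -
  obtain p q where pq: "{p..q} \<subseteq> K" "s \<in> {p..q}" "a \<in> {p..q}" "at s within K = at s within {p..q}"
    using interval_local_Icc[OF assms(1,3,2)] by metis
  have c: "continuous_on {p..q} \<beta>" using \<beta> pq(1) continuous_on_subset by blast
  have eq: "primitive_from a \<beta> u = integral {p..u} \<beta> - integral {p..a} \<beta>" if u: "u \<in> {p..q}" for u
  proof -
    have int: "\<beta> integrable_on {p..v}" if "v \<in> {p..q}" for v
      by (rule integrable_continuous_real) (rule continuous_on_subset[OF c], use that in auto)
    have *: "integral {p..v} \<beta> + integral {v..w} \<beta> = integral {p..w} \<beta>"
      if "v \<in> {p..q}" "w \<in> {p..q}" "v \<le> w" for v w
      using that int by (intro Henstock_Kurzweil_Integration.integral_combine) auto
    show ?thesis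
      using *[of a u] *[of u a] u pq(3) by (cases "a \<le> u") (auto simp: primitive_from_def algebra_simps)
  qed
  have "((\<lambda>u. integral {p..u} \<beta> - integral {p..a} \<beta>) has_vector_derivative \<beta> s - 0) (at s within {p..q})"
    by (intro has_vector_derivative_diff integral_has_vector_derivative[OF c pq(2)] has_vector_derivative_const)
  then have "(primitive_from a \<beta> has_vector_derivative \<beta> s) (at s within {p..q})"
    using has_vector_derivative_transform[OF pq(2), of "primitive_from a \<beta>" "\<lambda>u. integral {p..u} \<beta> - integral {p..a} \<beta>"] eq
    by simp
  then show ?thesis using pq(4) by simp
qed

text \<open>A base point is chosen in every connected component. The components of a relatively open subset
  of an interval are intervals and are themselves relatively open, so different choices do not interact.\<close>

lemma primitive_on_relatively_open:
  fixes \<beta> :: "real \<Rightarrow> 'b::banach"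
  assumes J: "is_interval J" and S: "openin (top_of_set J) S" and \<beta>: "continuous_on S \<beta>"
  obtains F where "\<And>s. s \<in> S \<Longrightarrow> (F has_vector_derivative \<beta> s) (at s within S)"
proof -
  define C where "C s = connected_component_set S s" for s
  define F where "F s = primitive_from (SOME a. a \<in> C s) \<beta> s" for s
  have "locally connected S"
    by (rule locally_open_subset[OF convex_imp_locally_connected S])
      (use J in \<open>simp add: is_interval_convex_1\<close>)
  then have opC: "openin (top_of_set S) (C s)" for s
    unfolding C_def by (rule openin_connected_component_locally_connected)
  have "(F has_vector_derivative \<beta> s) (at s within S)" if s: "s \<in> S" for s
  proof -
    obtain O' where O': "open O'" "C s = S \<inter> O'" using opC[of s] unfolding openin_open by blast
    have sC: "s \<in> C s" unfolding C_def using s by simp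
    define a where "a = (SOME a. a \<in> C s)"
    have a: "a \<in> C s" unfolding a_def using sC by (rule someI)
    have int: "is_interval (C s)" unfolding C_def is_interval_connected_1 by (rule connected_connected_component)
    have CS: "C s \<subseteq> S" using O'(2) by blast
    have "(primitive_from a \<beta> has_vector_derivative \<beta> s) (at s within C s)"
      by (rule primitive_from_has_vector_derivative[OF int a sC continuous_on_subset[OF \<beta> CS]])
    moreover have "F t = primitive_from a \<beta> t" if "t \<in> C s" for t
    proof -
      have "C t = C s" using that connected_component_eq unfolding C_def by metis
      then show ?thesis by (simp add: F_def a_def)
    qed
    ultimately have "(F has_vector_derivative \<beta> s) (at s within C s)"
      using has_vector_derivative_transform[OF sC] by metis
    moreover have "at s within C s = at s within S"
      by (rule at_within_nhd[of s O']) (use O' sC in auto)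
    ultimately show ?thesis by simp
  qed
  then show thesis using that by blast
qed

text \<open>To extend a function it suffices to extend its derivative to some \<open>w\<close>: a primitive of \<open>w\<close> agrees
  with the given function up to a constant.\<close>

lemma primitive_extension:
  fixes w :: "real \<Rightarrow> 'b::banach"
  assumes f: "\<And>s. s \<in> {p..q} \<Longrightarrow> (f has_vector_derivative w s) (at s within {p..q})"
    and w: "continuous_on UNIV w"
  obtains g where "\<And>s. (g has_vector_derivative w s) (at s)" "\<And>s. s \<in> {p..q} \<Longrightarrow> g s = f s"
proof -
  have P: "(primitive_from p w has_vector_derivative w s) (at s)" for s
    using primitive_from_has_vector_derivative[of UNIV p s w] w by simp
  define g where "g s = primitive_from p w s + (f p - primitive_from p w p)" for s
  have g: "(g has_vector_derivative w s) (at s)" for s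
    unfolding g_def using has_vector_derivative_add[OF P has_vector_derivative_const] by simp
  have "g s = f s" if s: "s \<in> {p..q}" for s
  proof -
    have "((\<lambda>t. g t - f t) has_derivative (\<lambda>h. 0)) (at t within {p..q})" if "t \<in> {p..q}" for t
      using has_vector_derivative_diff[OF has_vector_derivative_at_within[OF g] f[OF that]]
      by (simp add: has_vector_derivative_def)
    from has_derivative_zero_unique[OF _ this, of s p] have "g s - f s = g p - f p"
      using s by simp
    then show ?thesis by (simp add: g_def)
  qed
  with g that show thesis by blast
qed

text \<open>The derivative is extended by its end values, which treats one-sided and
  two-sided neighborhoods alike.\<close>

lemma C1_extension:
  fixes f :: "real \<Rightarrow> 'b::banach"
  assumes "C1_on {p..q} f"
  obtains g where "C1_on UNIV g" "\<And>s. s \<in> {p..q} \<Longrightarrow> g s = f s"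
proof (cases "p \<le> q")
  case True
  obtain f' where f': "\<And>s. s \<in> {p..q} \<Longrightarrow> (f has_vector_derivative f' s) (at s within {p..q})"
    "continuous_on {p..q} f'" using assms by (rule C1_on_obtain_vector_derivative) blast
  define w where "w s = f' (max p (min s q))" for s
  have w: "continuous_on UNIV w"
    unfolding w_def by (rule continuous_on_compose2[OF f'(2)]) (use True in \<open>auto intro!: continuous_intros\<close>)
  have "(f has_vector_derivative w s) (at s within {p..q})" if "s \<in> {p..q}" for s
    using f'(1)[OF that] that by (simp add: w_def min_def max_def)
  then obtain g where "\<And>s. (g has_vector_derivative w s) (at s)" "\<And>s. s \<in> {p..q} \<Longrightarrow> g s = f s"
    using primitive_extension[OF _ w] by metis
  then show thesis using that C1_on_vector_derivative[of UNIV g w] w by auto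
next
  case False
  then show thesis using that[of "\<lambda>_. 0"] C1_on_const by auto
qed

text \<open>Near a regular point of the curve, a component \<open>c \<bullet> k\<close> has a local inverse \<open>h\<close>, and
  \<open>\<sigma> y = h (y \<bullet> k)\<close> recovers the parameter from the point. Put \<open>\<tau>\<^sub>b y = (y - c (\<sigma> y)) \<bullet> b\<close>, which
  vanishes on the curve. The obvious candidate \<open>F (\<sigma> y) + \<Sum>\<^sub>b \<tau>\<^sub>b y T (\<sigma> y) b\<close> has the
  right derivative on the curve but only the differentiability class of \<open>T\<close>. The difference
  \<open>(P (s + t) - P (s - t)) / 2\<close> with \<open>P' = T\<close>, which is d'Alembert's solution of the wave equation with
  initial position zero and initial velocity \<open>T\<close>, has the same first derivatives as
  \<open>t T s\<close> at \<open>t = 0\<close> and is twice continuously differentiable, so it replaces that product.\<close>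

lemma C2_local_prescribed_derivative:
  fixes c :: "real \<Rightarrow> 'a::euclidean_space" and F :: "real \<Rightarrow> 'b::banach"
    and T :: "real \<Rightarrow> 'a \<Rightarrow>\<^sub>L 'b"
  assumes c: "\<And>s. s \<in> {p..q} \<Longrightarrow> (c has_vector_derivative c' s) (at s within {p..q})"
    and c': "C1_on {p..q} c'" and T: "C1_on {p..q} T"
    and F: "\<And>s. s \<in> {p..q} \<Longrightarrow> (F has_vector_derivative T s (c' s)) (at s within {p..q})"
    and s0: "s0 \<in> {p..q}" and nz: "c' s0 \<noteq> 0"
  obtains W \<xi> U where "open W" "c s0 \<in> W" "C2_on W \<xi>" "open U" "s0 \<in> U"
    "\<And>s. s \<in> {p..q} \<Longrightarrow> s \<in> U \<Longrightarrow> \<xi> (c s) = F s \<and> (\<xi> has_derivative T s) (at (c s))"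
proof -
  obtain w where w: "C1_on UNIV w" "\<And>s. s \<in> {p..q} \<Longrightarrow> w s = c' s"
    using c' by (rule C1_extension) blast
  obtain T1 where T1: "C1_on UNIV T1" "\<And>s. s \<in> {p..q} \<Longrightarrow> T1 s = T s"
    using T by (rule C1_extension) blast
  have Tw: "C1_on UNIV (\<lambda>s. T1 s (w s))"
    by (rule C1_on_bilinear[OF bounded_bilinear_blinfun_apply T1(1) w(1)])
  have cont: "continuous_on UNIV w" "continuous_on UNIV (\<lambda>s. T1 s (w s))"
    using w(1) Tw C1_on_imp_continuous_on by blast+
  have "(c has_vector_derivative w s) (at s within {p..q})" if "s \<in> {p..q}" for s
    using c[OF that] w(2)[OF that] by simp
  from primitive_extension[OF this cont(1)] obtain c1 where c1: "\<And>s. (c1 has_vector_derivative w s) (at s)" "\<And>s. s \<in> {p..q} \<Longrightarrow> c1 s = c s"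
    by metis
  have "(F has_vector_derivative T1 s (w s)) (at s within {p..q})" if "s \<in> {p..q}" for s
    using F[OF that] w(2)[OF that] T1(2)[OF that] by simp
  from primitive_extension[OF this cont(2)] obtain F1 where F1: "\<And>s. (F1 has_vector_derivative T1 s (w s)) (at s)" "\<And>s. s \<in> {p..q} \<Longrightarrow> F1 s = F s"
    by metis
  define P where "P = primitive_from 0 T1"
  have P: "(P has_vector_derivative T1 s) (at s)" for s
    unfolding P_def using primitive_from_has_vector_derivative[of UNIV 0 s T1] T1(1) C1_on_imp_continuous_on by auto
  have C2: "C2_on UNIV c1" "C2_on UNIV F1" "C2_on UNIV P"
    using C2_on_vector_derivative[OF c1(1) w(1)] C2_on_vector_derivative[OF F1(1) Tw]
      C2_on_vector_derivative[OF P T1(1)] by blast+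
  obtain k where k: "k \<in> Basis" "w s0 \<bullet> k \<noteq> 0"
    using nz w(2)[OF s0] euclidean_all_zero_iff by metis
  have "C2_on UNIV (\<lambda>s. c1 s \<bullet> k)"
    by (intro C2_on_inner C2(1) C2_on_const)
  moreover have "((\<lambda>s. c1 s \<bullet> k) has_derivative (\<lambda>h. h *\<^sub>R w s0 \<bullet> k)) (at s0)"
    using c1(1)[of s0] unfolding has_vector_derivative_def by (rule has_derivative_inner_left)
  moreover have "inj (\<lambda>h. h *\<^sub>R w s0 \<bullet> k)"
    by (rule injI) (use k in simp)
  ultimately obtain U V h where h: "open U" "s0 \<in> U" "open V" "c1 s0 \<bullet> k \<in> V"
    "homeomorphism U V (\<lambda>s. c1 s \<bullet> k) h" "C2_on V h"
    using C2_inverse_function[OF open_UNIV, of "\<lambda>s. c1 s \<bullet> k" s0] by (metis UNIV_I)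
  define W where "W = (\<lambda>y. y \<bullet> k) -` V"
  have W: "open W" unfolding W_def by (intro open_vimage h(3) continuous_intros)
  define \<sigma> where "\<sigma> y = h (y \<bullet> k)" for y
  have \<sigma>: "C2_on W \<sigma>"
    unfolding \<sigma>_def by (rule C2_on_compose[OF h(6)]) (auto simp: W_def intro!: C2_on_inner C2_on_const C2_on_ident)
  define \<tau> where "\<tau> b y = (y - c1 (\<sigma> y)) \<bullet> b" for b y
  have comp: "C2_on W (\<lambda>y. f (g y))" if "C2_on UNIV f" "C2_on W g" for f :: "real \<Rightarrow> 'c::real_normed_vector" and g
    by (rule C2_on_compose[OF that]) simp
  have \<tau>: "C2_on W (\<tau> b)" for b
    unfolding \<tau>_def by (intro C2_on_inner C2_on_diff C2_on_ident C2_on_const comp[OF C2(1) \<sigma>])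
  define \<xi> where "\<xi> y = F1 (\<sigma> y) + (\<Sum>b\<in>Basis. (1/2) *\<^sub>R (P (\<sigma> y + \<tau> b y) b - P (\<sigma> y - \<tau> b y) b))" for y
  have "C2_on W \<xi>"
    unfolding \<xi>_def
    by (intro C2_on_add C2_on_sum C2_on_scaleR C2_on_const C2_on_diff comp[OF C2(2) \<sigma>]
        C2_on_bilinear[OF bounded_bilinear_blinfun_apply] comp[OF C2(3)] \<sigma> \<tau>)
  moreover have "\<xi> (c s) = F s \<and> (\<xi> has_derivative T s) (at (c s))" if s: "s \<in> {p..q}" "s \<in> U" for s
  proof -
    have \<sigma>s: "\<sigma> (c s) = s" using h(5) s c1(2)[OF s(1)] unfolding \<sigma>_def homeomorphism_def by metis
    have cW: "c s \<in> W"
      using h(5) s c1(2)[OF s(1)] unfolding W_def homeomorphism_def by (metis image_eqI vimageI)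
    have \<tau>s: "\<tau> b (c s) = 0" for b using c1(2)[OF s(1)] by (simp add: \<tau>_def \<sigma>s)
    obtain D where "(\<sigma> has_derivative blinfun_apply (D (c s))) (at (c s) within W)"
      using \<sigma> cW by (metis C2_on_derivative)
    then have D: "(\<sigma> has_derivative D (c s)) (at (c s))" using at_within_open[OF cW W] by simp
    define d where "d = blinfun_apply (D (c s))"
    note D = D[folded d_def]
    have chain: "((\<lambda>y. f (g y)) has_derivative (\<lambda>v. g' v *\<^sub>R f')) (at (c s))"
      if "(f has_vector_derivative f') (at (g (c s)))" "(g has_derivative g') (at (c s))"
      for f :: "real \<Rightarrow> 'c::real_normed_vector" and g f' g'
      using has_derivative_compose[OF that(2) that(1)[unfolded has_vector_derivative_def]] .
    have c1': "((\<lambda>y. c1 (\<sigma> y)) has_derivative (\<lambda>v. d v *\<^sub>R w s)) (at (c s))"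
      by (rule chain[OF _ D]) (simp add: \<sigma>s c1(1))
    define t where "t b v = (v - d v *\<^sub>R w s) \<bullet> b" for b v
    have \<tau>': "(\<tau> b has_derivative t b) (at (c s))" for b
      unfolding \<tau>_def t_def by (intro has_derivative_inner_left has_derivative_diff has_derivative_ident c1')
    have P1: "((\<lambda>y. P (\<sigma> y + \<tau> b y)) has_derivative (\<lambda>v. (d v + t b v) *\<^sub>R T s)) (at (c s))"
      and P2: "((\<lambda>y. P (\<sigma> y - \<tau> b y)) has_derivative (\<lambda>v. (d v - t b v) *\<^sub>R T s)) (at (c s))" for b
      using P[of s] T1(2)[OF s(1)]
      by (auto intro!: chain has_derivative_add has_derivative_diff D \<tau>' simp: \<sigma>s \<tau>s)
    have "((\<lambda>y. F1 (\<sigma> y)) has_derivative (\<lambda>v. d v *\<^sub>R T1 s (w s))) (at (c s))"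
      by (rule chain[OF _ D]) (simp add: \<sigma>s F1(1))
    then have "(\<xi> has_derivative (\<lambda>v. d v *\<^sub>R T1 s (w s) +
        (\<Sum>b\<in>Basis. (1/2) *\<^sub>R (((d v + t b v) *\<^sub>R T s) b - ((d v - t b v) *\<^sub>R T s) b)))) (at (c s))"
      unfolding \<xi>_def
      by (intro has_derivative_add has_derivative_sum has_derivative_scaleR_right has_derivative_diff
          bounded_linear.has_derivative[OF blinfun.bounded_linear_left] P1 P2)
    moreover have "d v *\<^sub>R T1 s (w s) +
        (\<Sum>b\<in>Basis. (1/2) *\<^sub>R (((d v + t b v) *\<^sub>R T s) b - ((d v - t b v) *\<^sub>R T s) b)) = T s v" for v
    proof -
      have "(1/2) *\<^sub>R (((d v + t b v) *\<^sub>R T s) b - ((d v - t b v) *\<^sub>R T s) b) = T s (t b v *\<^sub>R b)" for b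
        by (simp add: blinfun.bilinear_simps algebra_simps flip: scaleR_add_left)
      then have "(\<Sum>b\<in>Basis. (1/2) *\<^sub>R (((d v + t b v) *\<^sub>R T s) b - ((d v - t b v) *\<^sub>R T s) b))
          = T s (\<Sum>b\<in>Basis. t b v *\<^sub>R b)"
        by (simp add: blinfun.sum_right)
      also have "(\<Sum>b\<in>Basis. t b v *\<^sub>R b) = v - d v *\<^sub>R w s"
        unfolding t_def by (rule euclidean_representation)
      finally show ?thesis using T1(2)[OF s(1)] by (simp add: blinfun.bilinear_simps)
    qed
    ultimately have "(\<xi> has_derivative T s) (at (c s))" by simp
    moreover have "\<xi> (c s) = F s"
      by (simp add: \<xi>_def \<sigma>s \<tau>s F1(2)[OF s(1)])
    ultimately show ?thesis by blast
  qed
  ultimately show thesis using that[OF W] h(1,2,4) c1(2)[OF s0] unfolding W_def by auto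
qed

section \<open>Prescribing the derivative along a curve\<close>

text \<open>The values on the curve are forced up to constants: they are primitives of \<open>T s (c' s)\<close>. Fixing
  them first makes the local solutions agree on the curve, so that they can be glued. That the curve is a
  homeomorphism onto its image keeps the parameters of nearby points of the curve near one
  another; the local solutions know only a short piece of the curve.\<close>

lemma C2_prescribed_derivative_along_curve:
  fixes c :: "real \<Rightarrow> 'a::euclidean_space" and T :: "real \<Rightarrow> 'a \<Rightarrow>\<^sub>L 'b::banach"
  assumes J: "is_interval J" and S: "openin (top_of_set J) S"
    and c: "\<And>s. s \<in> S \<Longrightarrow> (c has_vector_derivative c' s) (at s within S)"
    and c': "C1_on S c'" and nz: "\<And>s. s \<in> S \<Longrightarrow> c' s \<noteq> 0"
    and hom: "homeomorphism S (c ` S) c g" and T: "C1_on S T"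
  obtains W \<xi> where "open W" "c ` S \<subseteq> W" "C2_on W \<xi>"
    "\<And>s. s \<in> S \<Longrightarrow> (\<xi> has_derivative T s) (at (c s))"
proof -
  have "C1_on S (\<lambda>s. T s (c' s))"
    by (rule C1_on_bilinear[OF bounded_bilinear_blinfun_apply T c'])
  then obtain F where F: "\<And>s. s \<in> S \<Longrightarrow> (F has_vector_derivative T s (c' s)) (at s within S)"
    using primitive_on_relatively_open[OF J S] C1_on_imp_continuous_on by metis
  have g: "g (c s) = s" if "s \<in> S" for s using hom that unfolding homeomorphism_def by blast
  have "\<exists>W \<xi>. open W \<and> y \<in> W \<and> C2_on W \<xi> \<and>
      (\<forall>z\<in>c ` S \<inter> W. \<xi> z = F (g z) \<and> (\<xi> has_derivative T (g z)) (at z))" if "y \<in> c ` S" for y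
  proof -
    obtain s0 where s0: "s0 \<in> S" "y = c s0" using \<open>y \<in> c ` S\<close> by blast
    obtain O' where O': "open O'" "S = J \<inter> O'" using S unfolding openin_open by blast
    obtain e where e: "0 < e" "ball s0 e \<subseteq> O'" using O' s0(1) openE by blast
    define I where "I = J \<inter> ball s0 e"
    have I: "is_interval I" "s0 \<in> I" "I \<subseteq> S"
      unfolding I_def using J e O' s0(1) by (auto intro!: is_interval_Int simp: is_interval_ball_real)
    obtain p q where pq: "{p..q} \<subseteq> I" "s0 \<in> {p..q}" "eventually (\<lambda>t. t \<in> I \<longrightarrow> t \<in> {p..q}) (nhds s0)"
      using interval_local_Icc[OF I(1,2,2)] by metis
    have sub: "{p..q} \<subseteq> S" using pq(1) I(3) by blast
    have 1: "(c has_vector_derivative c' s) (at s within {p..q})" if "s \<in> {p..q}" for s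
      using c that sub has_vector_derivative_within_subset by blast
    have 2: "(F has_vector_derivative T s (c' s)) (at s within {p..q})" if "s \<in> {p..q}" for s
      using F that sub has_vector_derivative_within_subset by blast
    obtain W \<xi> U where W: "open W" "c s0 \<in> W" "C2_on W \<xi>" "open U" "s0 \<in> U"
      and \<xi>: "\<And>s. s \<in> {p..q} \<Longrightarrow> s \<in> U \<Longrightarrow> \<xi> (c s) = F s \<and> (\<xi> has_derivative T s) (at (c s))"
      using C2_local_prescribed_derivative[OF 1 C1_on_subset[OF c' sub] C1_on_subset[OF T sub] 2 pq(2) nz[OF s0(1)]]
      by metis
    obtain Q where Q: "open Q" "s0 \<in> Q" "\<And>t. t \<in> Q \<Longrightarrow> t \<in> I \<Longrightarrow> t \<in> {p..q}"
      using pq(3) unfolding eventually_nhds by blast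
    define Q' where "Q' = Q \<inter> U \<inter> ball s0 e"
    have "openin (top_of_set S) (S \<inter> Q')"
      unfolding Q'_def using Q W by (intro openin_open_Int open_Int) auto
    then have "openin (top_of_set (c ` S)) (c ` (S \<inter> Q'))"
      by (rule homeomorphism_imp_open_map[OF hom])
    then obtain W2 where W2: "open W2" "c ` (S \<inter> Q') = c ` S \<inter> W2"
      unfolding openin_open by blast
    have "s0 \<in> S \<inter> Q'" using Q W e(1) s0(1) unfolding Q'_def by simp
    then have "y \<in> W2" using W2(2) s0(2) by blast
    moreover have "\<xi> z = F (g z) \<and> (\<xi> has_derivative T (g z)) (at z)" if z: "z \<in> c ` S \<inter> (W \<inter> W2)" for z
    proof -
      obtain s where s: "s \<in> S" "s \<in> Q'" "z = c s" using z W2(2) by blast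
      then have "s \<in> {p..q}" "s \<in> U" using Q(3)[of s] O'(2) unfolding Q'_def I_def by auto
      then show ?thesis using \<xi> g[OF s(1)] s(3) by simp
    qed
    moreover have "C2_on (W \<inter> W2) \<xi>" by (rule C2_on_subset[OF W(3)]) simp
    ultimately show ?thesis using W(1,2) W2(1) s0(2) by (intro exI[of _ "W \<inter> W2"] exI[of _ \<xi>]) auto
  qed
  then obtain W \<xi> where "open W" "c ` S \<subseteq> W" "C2_on W \<xi>"
    "\<And>z. z \<in> c ` S \<Longrightarrow> (\<xi> has_derivative T (g z)) (at z)"
    by (rule C2_glue_prescribed_derivatives[of "c ` S" "\<lambda>z. F (g z)" "\<lambda>z. T (g z)"]) blast+
  then show thesis using that[of W \<xi>] g by (metis imageI)
qed

section \<open>Integral curves without self-intersections\<close>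

lemma interval_point_near:
  fixes J :: "real set"
  assumes J: "is_interval J" "interior J \<noteq> {}" and s: "s \<in> J" and e: "0 < e"
  obtains a where "a \<in> J" "a \<noteq> s" "dist s a < e"
proof -
  have "interior J \<noteq> {s}" using open_interior[of J] not_open_singleton by metis
  then obtain b where b: "b \<in> interior J" "b \<noteq> s" using J(2) by blast
  then have bJ: "b \<in> J" using interior_subset by blast
  define m where "m = min (\<bar>b - s\<bar>) (e/2)"
  have m: "0 < m" "m \<le> \<bar>b - s\<bar>" "m < e" using b e by (auto simp: m_def)
  define a where "a = (if s < b then s + m else s - m)"
  have "a \<in> J"
  proof (cases "s < b")
    case True
    then show ?thesis using mem_is_interval_1_I[OF J(1) s bJ, of a] m by (auto simp: a_def)
  next
    case False
    then show ?thesis using mem_is_interval_1_I[OF J(1) bJ s, of a] m by (auto simp: a_def)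
  qed
  then show thesis using that[of a] m by (auto simp: a_def dist_real_def)
qed

text \<open>Suppose that the field vanishes at a point of the curve. Being differentiable there, it is bounded by a
  multiple of the distance from that point. By the mean value inequality the maximal distance \<open>m\<close> of the
  curve from the point over a short enough parameter interval satisfies \<open>m \<le> m/2\<close>, so the
  curve rests at the point, against injectivity.\<close>

lemma injective_solution_regular:
  fixes c :: "real \<Rightarrow> 'a::real_normed_vector"
  assumes J: "is_interval J" "interior J \<noteq> {}" and S: "openin (top_of_set J) S"
    and c: "\<And>s. s \<in> S \<Longrightarrow> (c has_vector_derivative X (c s)) (at s within S)"
    and inj: "inj_on c S" and s0: "s0 \<in> S"
    and X: "X differentiable (at (c s0))"
  shows "X (c s0) \<noteq> 0"
proof
  assume zero: "X (c s0) = 0"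
  obtain X' where X': "(X has_derivative X') (at (c s0))" using X unfolding differentiable_def by blast
  obtain B where B: "0 \<le> B" "\<And>h. norm (X' h) \<le> norm h * B"
    using has_derivative_bounded_linear[OF X'] bounded_linear.nonneg_bounded by blast
  obtain d where d: "0 < d" "\<And>y. norm (y - c s0) < d \<Longrightarrow> norm (X y - X (c s0) - X' (y - c s0)) \<le> 1 * norm (y - c s0)"
    using X' unfolding has_derivative_within_alt by (metis UNIV_I zero_less_one)
  define L where "L = B + 1"
  have L: "0 < L" using B(1) by (simp add: L_def)
  have lip: "norm (X y) \<le> L * norm (y - c s0)" if "norm (y - c s0) < d" for y
    using d(2)[OF that] B(2)[of "y - c s0"] norm_triangle_sub[of "X y" "X' (y - c s0)"] zero
    by (simp add: L_def algebra_simps)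
  have cont: "continuous_on S c"
    using c has_vector_derivative_continuous continuous_on_eq_continuous_within by blast
  then obtain e1 where e1: "0 < e1" "\<And>t. t \<in> S \<Longrightarrow> dist t s0 < e1 \<Longrightarrow> dist (c t) (c s0) < d"
    using s0 d(1) unfolding continuous_on_iff by metis
  obtain O' where O': "open O'" "S = J \<inter> O'" using S unfolding openin_open by blast
  obtain e2 where e2: "0 < e2" "ball s0 e2 \<subseteq> O'" using O' s0 openE by blast
  define e where "e = min (min e1 e2) (1 / (2 * L))"
  have e: "0 < e" "e \<le> e1" "e \<le> e2" "e \<le> 1 / (2 * L)" using e1 e2 L by (auto simp: e_def)
  obtain a where a: "a \<in> J" "a \<noteq> s0" "dist s0 a < e"
    using interval_point_near[OF J _ e(1)] s0 O'(2) by blast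
  define I where "I = closed_segment s0 a"
  have I: "convex I" "compact I" "s0 \<in> I" "a \<in> I" unfolding I_def by auto
  have Ie: "dist s0 t < e" if "t \<in> I" for t
    using that a(3) e(1) unfolding I_def by (auto simp: closed_segment_eq_real_ivl dist_real_def split: if_splits)
  have "I \<subseteq> J" unfolding I_def using J(1) a(1) s0 O'(2) by (simp add: closed_segment_subset is_interval_convex_1)
  then have IS: "I \<subseteq> S" using Ie e(3) e2(2) O'(2) by fastforce
  have "continuous_on I (\<lambda>t. norm (c t - c s0))"
    by (intro continuous_intros continuous_on_subset[OF cont IS])
  then obtain t1 where t1: "t1 \<in> I" "\<And>t. t \<in> I \<Longrightarrow> norm (c t - c s0) \<le> norm (c t1 - c s0)"
    using continuous_attains_sup[OF I(2)] I(3) by (metis empty_iff)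
  define m where "m = norm (c t1 - c s0)"
  have "norm (c t1 - c s0) \<le> (L * m) * norm (t1 - s0)"
  proof (rule differentiable_bound[OF I(1) _ _ t1(1) I(3)])
    show "(c has_derivative (\<lambda>h. h *\<^sub>R X (c t))) (at t within I)" if "t \<in> I" for t
      using c[of t] IS that has_vector_derivative_within_subset
      unfolding has_vector_derivative_def[symmetric] by blast
    show "onorm (\<lambda>h. h *\<^sub>R X (c t)) \<le> L * m" if t: "t \<in> I" for t
    proof (rule onorm_bound)
      have "norm (c t - c s0) < d"
        using e1(2)[of t] IS t Ie[OF t] e(2) by (auto simp: dist_norm norm_minus_commute dist_commute)
      then have "norm (X (c t)) \<le> L * norm (c t - c s0)" by (rule lip)
      also have "\<dots> \<le> L * m" unfolding m_def using t1(2)[OF t] L by simp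
      finally have "norm (X (c t)) \<le> L * m" .
      then show "norm (h *\<^sub>R X (c t)) \<le> L * m * norm h" for h
        using mult_left_mono[of "norm (X (c t))" "L * m" "norm h"] by (simp add: mult.commute)
    qed (use L in \<open>simp add: m_def\<close>)
  qed
  also have "\<dots> \<le> (L * m) * (1 / (2 * L))"
    using Ie[OF t1(1)] e(4) L by (intro mult_left_mono) (auto simp: m_def dist_real_def)
  also have "\<dots> = m / 2" using L by simp
  finally have "m \<le> m / 2" by (simp add: m_def)
  moreover have "0 \<le> m" by (simp add: m_def)
  ultimately have "m = 0" by linarith
  then have "c a = c s0" using t1(2)[OF I(4)] by (simp add: m_def)
  then show False using inj a(2) I(4) IS s0 unfolding inj_on_def by blast
qed

section \<open>Charts and tangent vectors\<close>

lemma chart_inv_left: "is_chart c \<Longrightarrow> q \<in> fst c \<Longrightarrow> chart_inv c (snd c q) = q"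
  unfolding is_chart_def homeomorphism_def by blast

lemma chart_inv_right: "y \<in> snd c ` fst c \<Longrightarrow> snd c (chart_inv c y) = y"
  by (rule f_inv_into_f)

lemma chart_open_image:
  assumes c: "is_chart c" and G: "open G" "G \<subseteq> fst c"
  shows "open (snd c ` G)"
proof -
  have hom: "homeomorphism (fst c) (snd c ` fst c) (snd c) (chart_inv c)" and op: "open (snd c ` fst c)"
    using c unfolding is_chart_def by auto
  have "openin (top_of_set (fst c)) G" using G by (simp add: openin_open_eq c[unfolded is_chart_def])
  then have "openin (top_of_set (snd c ` fst c)) (snd c ` G)"
    by (rule homeomorphism_imp_open_map[OF hom])
  then show ?thesis using op openin_open_trans by blast
qed

lemma chart_open_vimage:
  assumes c: "is_chart c" and W: "open W"
  shows "open {q \<in> fst c. snd c q \<in> W}"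
proof -
  have "continuous_on (fst c) (snd c)" "open (fst c)"
    using c unfolding is_chart_def homeomorphism_def by auto
  then have "open (fst c \<inter> snd c -` W)" using W by (rule continuous_open_preimage)
  then show ?thesis by (simp add: Int_def vimage_def)
qed

lemma charts_is_chart: "c \<in> charts M \<Longrightarrow> is_chart c"
  unfolding charts_def by simp

text \<open>Two members of the maximal atlas are only known to be compatible with the given atlas, so the
  transition is factored through a chart of the latter.\<close>

lemma charts_transition_differentiable:
  assumes M: "is_atlas M" and c: "c \<in> charts M" and d: "d \<in> charts M" and p: "p \<in> fst c" "p \<in> fst d"
  obtains D where "((\<lambda>y. snd d (chart_inv c y)) has_derivative D) (at (snd c p))"
proof -
  obtain m where m: "m \<in> M" "p \<in> fst m" using M unfolding is_atlas_def by blast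
  have mc: "is_chart m" using M m unfolding is_atlas_def by blast
  note cc = charts_is_chart[OF c] and dc = charts_is_chart[OF d]
  have op: "open (fst c)" "open (fst d)" "open (fst m)" using cc dc mc unfolding is_chart_def by auto
  have "C2_on (snd c ` (fst c \<inter> fst m)) (snd m \<circ> chart_inv c)"
    using c m unfolding charts_def compatible_def by blast
  then obtain f' where "((snd m \<circ> chart_inv c) has_derivative blinfun_apply (f' (snd c p))) (at (snd c p) within snd c ` (fst c \<inter> fst m))"
    by (rule C2_on_derivative) (use p m in blast)
  moreover have "open (snd c ` (fst c \<inter> fst m))" by (rule chart_open_image[OF cc]) (use op in auto)
  ultimately have 1: "((snd m \<circ> chart_inv c) has_derivative f' (snd c p)) (at (snd c p))"
    using p m at_within_open by (metis IntI imageI)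
  have "C2_on (snd m ` (fst d \<inter> fst m)) (snd d \<circ> chart_inv m)"
    using d m unfolding charts_def compatible_def by blast
  then obtain g' where "((snd d \<circ> chart_inv m) has_derivative blinfun_apply (g' (snd m p))) (at (snd m p) within snd m ` (fst d \<inter> fst m))"
    by (rule C2_on_derivative) (use p m in blast)
  moreover have "open (snd m ` (fst d \<inter> fst m))" by (rule chart_open_image[OF mc]) (use op in auto)
  ultimately have 2: "((snd d \<circ> chart_inv m) has_derivative g' (snd m p)) (at (snd m p))"
    using p m at_within_open by (metis IntI imageI)
  have "(snd m \<circ> chart_inv c) (snd c p) = snd m p" using chart_inv_left[OF cc p(1)] by simp
  with has_derivative_compose[OF 1] 2
  have "((\<lambda>y. (snd d \<circ> chart_inv m) ((snd m \<circ> chart_inv c) y)) has_derivative (\<lambda>v. g' (snd m p) (f' (snd c p) v))) (at (snd c p))"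
    by metis
  moreover have "open (snd c ` (fst c \<inter> fst m \<inter> fst d))" by (rule chart_open_image[OF cc]) (use op in auto)
  moreover have "snd c p \<in> snd c ` (fst c \<inter> fst m \<inter> fst d)" using p m by blast
  moreover have "(snd d \<circ> chart_inv m) ((snd m \<circ> chart_inv c) y) = snd d (chart_inv c y)"
    if "y \<in> snd c ` (fst c \<inter> fst m \<inter> fst d)" for y
    using that chart_inv_left[OF cc] chart_inv_left[OF mc] by auto
  ultimately have "((\<lambda>y. snd d (chart_inv c y)) has_derivative (\<lambda>v. g' (snd m p) (f' (snd c p) v))) (at (snd c p))"
    by (rule has_derivative_transform_within_open)
  then show thesis by (rule that)
qed

text \<open>Differentiability of a function at a point does not depend on the chart; coordinate vectors are
  zero on nondifferentiable functions, so this is part of their transformation law.\<close>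

lemma chain_rule_charts:
  assumes c: "is_chart c" and d: "is_chart d" and p: "p \<in> fst c" "p \<in> fst d"
    and D: "((\<lambda>y. snd d (chart_inv c y)) has_derivative D) (at (snd c p))"
    and L: "((f \<circ> chart_inv d) has_derivative L) (at (snd d p))"
  shows "((f \<circ> chart_inv c) has_derivative (\<lambda>v. L (D v))) (at (snd c p))"
proof -
  have "((f \<circ> chart_inv d) has_derivative L) (at (snd d (chart_inv c (snd c p))))"
    using L chart_inv_left[OF c p(1)] by simp
  from has_derivative_compose[OF D this]
  have "((\<lambda>y. (f \<circ> chart_inv d) (snd d (chart_inv c y))) has_derivative (\<lambda>v. L (D v))) (at (snd c p))" .
  moreover have "open (snd c ` (fst c \<inter> fst d))"
    by (rule chart_open_image[OF c]) (use c d in \<open>auto simp: is_chart_def\<close>)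
  moreover have "snd c p \<in> snd c ` (fst c \<inter> fst d)" using p by blast
  moreover have "(f \<circ> chart_inv d) (snd d (chart_inv c y)) = (f \<circ> chart_inv c) y"
    if "y \<in> snd c ` (fst c \<inter> fst d)" for y
    using that chart_inv_left[OF c] chart_inv_left[OF d] by auto
  ultimately show ?thesis by (rule has_derivative_transform_within_open)
qed

lemma coord_vec_change:
  assumes M: "is_atlas M" and c: "c \<in> charts M" and d: "d \<in> charts M" and p: "p \<in> fst c" "p \<in> fst d"
    and D: "((\<lambda>y. snd d (chart_inv c y)) has_derivative D) (at (snd c p))"
  shows "coord_vec c p a = coord_vec d p (D a)"
proof
  fix f
  note cc = charts_is_chart[OF c] and dc = charts_is_chart[OF d]
  obtain D' where D': "((\<lambda>y. snd c (chart_inv d y)) has_derivative D') (at (snd d p))"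
    using charts_transition_differentiable[OF M d c p(2,1)] .
  show "coord_vec c p a f = coord_vec d p (D a) f"
  proof (cases "(f \<circ> chart_inv d) differentiable (at (snd d p))")
    case True
    then obtain L where L: "((f \<circ> chart_inv d) has_derivative L) (at (snd d p))"
      unfolding differentiable_def by blast
    have L': "((f \<circ> chart_inv c) has_derivative (\<lambda>v. L (D v))) (at (snd c p))"
      by (rule chain_rule_charts[OF cc dc p D L])
    show ?thesis
      unfolding coord_vec_def using L L' frechet_derivative_at[OF L, symmetric] frechet_derivative_at[OF L', symmetric]
      by (auto simp: differentiable_def)
  next
    case False
    then have "\<not> (f \<circ> chart_inv c) differentiable (at (snd c p))"
      using chain_rule_charts[OF dc cc p(2,1) D'] unfolding differentiable_def by blast
    then show ?thesis using False by (simp add: coord_vec_def)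
  qed
qed

lemma coordinate_function_has_derivative:
  assumes c: "is_chart c" and p: "p \<in> fst c"
  shows "(((\<lambda>q. snd c q $ i) \<circ> chart_inv c) has_derivative (\<lambda>v. v $ i)) (at (snd c p))"
proof -
  have "((\<lambda>y. y $ i) has_derivative (\<lambda>v. v $ i)) (at (snd c p))"
    by (rule bounded_linear_imp_has_derivative) (rule bounded_linear_vec_nth)
  moreover have "open (snd c ` fst c)" "snd c p \<in> snd c ` fst c" using c p by (auto simp: is_chart_def)
  ultimately show ?thesis
    by (rule has_derivative_transform_within_open) (simp add: f_inv_into_f)
qed

lemma coord_comp_coord_vec:
  assumes c: "is_chart c" and p: "p \<in> fst c"
  shows "coord_comp c (coord_vec c p a) = a"
proof -
  have "coord_vec c p a (\<lambda>q. snd c q $ i) = a $ i" for i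
    using coordinate_function_has_derivative[OF c p, of i]
      frechet_derivative_at[OF coordinate_function_has_derivative[OF c p, of i], symmetric]
    by (auto simp: coord_vec_def differentiable_def)
  then show ?thesis by (simp add: coord_comp_def vec_eq_iff)
qed

lemma tangent_space_coord_vec:
  assumes M: "is_atlas M" and c: "c \<in> charts M" and p: "p \<in> fst c" and v: "v \<in> tangent_space M p"
  shows "v = coord_vec c p (coord_comp c v)"
proof -
  obtain d a where d: "v = coord_vec d p a" "d \<in> charts M" "p \<in> fst d"
    using v unfolding tangent_space_def by blast
  obtain D where "((\<lambda>y. snd c (chart_inv d y)) has_derivative D) (at (snd d p))"
    using charts_transition_differentiable[OF M d(2) c d(3) p] .
  then have "v = coord_vec c p (D a)"
    using coord_vec_change[OF M d(2) c d(3) p] d(1) by simp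
  then show ?thesis using coord_comp_coord_vec[OF charts_is_chart[OF c] p] by simp
qed

text \<open>By the inverse function theorem \<open>\<xi>\<close> is a diffeomorphism of class two near the point, so composing the
  given chart with it gives a chart, compatible with all others because the given one is.\<close>

lemma chart_of_local_diffeomorphism:
  assumes M: "is_atlas M" and u: "(U, u) \<in> charts M" and p: "p \<in> U"
    and W: "open W" "u p \<in> W" and \<xi>: "C2_on W \<xi>" and D: "(\<xi> has_derivative D) (at (u p))" "inj D"
  obtains G where "p \<in> G" "G \<subseteq> U" "(G, \<xi> \<circ> u) \<in> charts M"
proof -
  let ?c = "(U, u)"
  have uc: "is_chart ?c" using charts_is_chart[OF u] .
  have "open (u ` U)" using uc by (simp add: is_chart_def)
  then have "open (u ` U \<inter> W)" using W by blast
  moreover have "C2_on (u ` U \<inter> W) \<xi>" by (rule C2_on_subset[OF \<xi>]) simp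
  moreover have "u p \<in> u ` U \<inter> W" using p W by blast
  ultimately obtain A B g where A: "open A" "A \<subseteq> u ` U \<inter> W" "u p \<in> A" and B: "open B" "\<xi> (u p) \<in> B"
    and hom: "homeomorphism A B \<xi> g" and g: "C2_on B g"
    using C2_inverse_function[of "u ` U \<inter> W" \<xi> "u p"] D by metis
  define G where "G = {q \<in> U. u q \<in> A}"
  have G: "open G" "p \<in> G" "G \<subseteq> U"
    unfolding G_def using chart_open_vimage[OF uc A(1)] p A(3) by auto
  have uG: "u ` G = A" unfolding G_def using A(2) by auto
  have xG: "(\<xi> \<circ> u) ` G = B" using hom uG unfolding homeomorphism_def by (metis image_comp)
  define v where "v = inv_into U u"
  have v: "v (u q) = q" if "q \<in> U" for q using chart_inv_left[OF uc] that by (simp add: v_def)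
  have g\<xi>: "g (\<xi> y) = y" if "y \<in> A" for y using hom that unfolding homeomorphism_def by blast
  have "homeomorphism U (u ` U) u v" using uc by (simp add: is_chart_def v_def)
  then have "homeomorphism G A u v"
    by (rule homeomorphism_of_subsets) (use G uG A(2) in auto)
  then have hG: "homeomorphism G B (\<xi> \<circ> u) (v \<circ> g)"
    using hom by (rule homeomorphism_compose)
  have inv: "inv_into G (\<xi> \<circ> u) z = v (g z)" if "z \<in> B" for z
  proof -
    have "z \<in> (\<xi> \<circ> u) ` G" using that xG by simp
    then obtain q where q: "q \<in> G" "z = \<xi> (u q)" by auto
    have "inj_on (\<xi> \<circ> u) G" using hG unfolding homeomorphism_def by (metis inj_on_inverseI)
    then have "inv_into G (\<xi> \<circ> u) z = q" using q by (metis comp_apply inv_into_f_f)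
    then show ?thesis using q v g\<xi> G(3) uG by auto
  qed
  have "homeomorphism G B (\<xi> \<circ> u) (inv_into G (\<xi> \<circ> u))"
    by (rule homeomorphism_cong[OF hG refl refl]) (use inv in auto)
  then have chart: "is_chart (G, \<xi> \<circ> u)"
    using G(1) B(1) xG by (simp add: is_chart_def)
  have "compatible (G, \<xi> \<circ> u) d" if d: "d \<in> M" for d
  proof -
    have comp: "compatible ?c d" using u d unfolding charts_def by blast
    then have c1: "C2_on (u ` (U \<inter> fst d)) (snd d \<circ> v)"
      and c2: "C2_on (snd d ` (U \<inter> fst d)) (u \<circ> chart_inv d)"
      unfolding compatible_def v_def by auto
    have dc: "is_chart d" using M d unfolding is_atlas_def by blast
    let ?Z = "(\<xi> \<circ> u) ` (G \<inter> fst d)"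
    have ZB: "?Z \<subseteq> B" using xG by blast
    have "C2_on ?Z (\<lambda>z. (snd d \<circ> v) (g z))"
      by (rule C2_on_compose[OF c1 C2_on_subset[OF g ZB]]) (use g\<xi> uG G(3) in auto)
    then have "C2_on ?Z (snd d \<circ> inv_into G (\<xi> \<circ> u))"
      by (subst C2_on_cong[where g="\<lambda>z. (snd d \<circ> v) (g z)"]) (use ZB inv in auto)
    moreover have "C2_on (snd d ` (G \<inter> fst d)) (\<lambda>y. \<xi> ((u \<circ> chart_inv d) y))"
    proof (rule C2_on_compose[OF \<xi> C2_on_subset[OF c2]])
      show "(u \<circ> chart_inv d) ` snd d ` (G \<inter> fst d) \<subseteq> W"
        using chart_inv_left[OF dc] uG A(2) by auto
    qed (use G(3) in blast)
    then have "C2_on (snd d ` (G \<inter> fst d)) ((\<xi> \<circ> u) \<circ> chart_inv d)"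
      by (simp add: comp_def)
    ultimately show ?thesis by (simp add: compatible_def)
  qed
  then have "(G, \<xi> \<circ> u) \<in> charts M" using chart by (simp add: charts_def)
  then show thesis using that G(2,3) by blast
qed

text \<open>\<open>T s\<close> is the inverse of the matrix with columns \<open>e i s\<close>; it is the derivative that
  coordinates must have at a point for their coordinate vectors to be the \<open>e i s\<close>.\<close>

lemma C1_dual_frame:
  fixes e :: "'n::finite \<Rightarrow> 'a::real_normed_vector \<Rightarrow> real^'n"
  assumes e: "\<And>i. C1_on S (e i)"
    and span: "\<And>s b. s \<in> S \<Longrightarrow> \<exists>a. b = (\<Sum>i\<in>UNIV. a $ i *\<^sub>R e i s)"
  obtains T :: "'a \<Rightarrow> (real^'n) \<Rightarrow>\<^sub>L (real^'n)" where "C1_on S T" "\<And>s. s \<in> S \<Longrightarrow> inj (T s)"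
    "\<And>s i. s \<in> S \<Longrightarrow> T s (e i s) = axis i 1"
proof -
  define A where "A s = (\<Sum>i\<in>UNIV. blinfun_scaleR_left (e i s) o\<^sub>L Blinfun (\<lambda>v. v $ i))" for s
  have A: "A s v = (\<Sum>i\<in>UNIV. v $ i *\<^sub>R e i s)" for s v
    by (simp add: A_def blinfun.sum_left bounded_linear_Blinfun_apply bounded_linear_vec_nth)
  have C1A: "C1_on S A"
    unfolding A_def
    by (intro C1_on_sum C1_on_blinfun_compose C1_on_const C1_on_linear_image[OF bounded_linear_blinfun_scaleR_left] e)
  have "\<exists>L. linear L \<and> (\<forall>v. L (A s v) = v) \<and> (\<forall>v. A s (L v) = v)" if "s \<in> S" for s
  proof (rule linear_surjective_isomorphism)
    show "linear (blinfun_apply (A s))"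
      by (simp only: linear_conv_bounded_linear blinfun.bounded_linear_right)
    show "surj (blinfun_apply (A s))"
      unfolding surj_def A by (rule allI) (rule span[OF that])
  qed simp
  then obtain L where L: "\<And>s. s \<in> S \<Longrightarrow> linear (L s)" "\<And>s v. s \<in> S \<Longrightarrow> L s (A s v) = v"
    "\<And>s v. s \<in> S \<Longrightarrow> A s (L s v) = v" by metis
  define T where "T s = Blinfun (L s)" for s
  have T: "blinfun_apply (T s) = L s" if "s \<in> S" for s
    unfolding T_def using L(1)[OF that] by (simp add: bounded_linear_Blinfun_apply linear_conv_bounded_linear)
  show thesis
  proof (rule that)
    show "C1_on S T"
      by (rule C1_on_blinfun_inverse[OF C1A]) (auto intro!: blinfun_eqI simp: T L)
    show "inj (T s)" if "s \<in> S" for s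
      using L(3)[OF that] by (metis T that injI)
    show "T s (e i s) = axis i 1" if "s \<in> S" for s i
    proof -
      have "A s (axis i 1) = e i s"
        unfolding A by (subst sum.remove[of _ i]) (auto simp: axis_def)
      then show ?thesis using L(2)[OF that, of "axis i 1"] by (simp add: T that)
    qed
  qed
qed

section \<open>Coordinates adapted to a frame along a path\<close>

text \<open>The velocity is a tangent vector defined through test functions; evaluated on the coordinate functions it
  gives the derivative of the coordinate expression of the path.\<close>

lemma velocity_coord_comp:
  assumes u: "(U, u) \<in> charts M" and s: "s \<in> J" "\<gamma> s \<in> U" and lim: "at s within J \<noteq> bot"
    and c: "((\<lambda>t. u (\<gamma> t)) has_vector_derivative w) (at s within J)"
  shows "coord_comp (U, u) (velocity M J \<gamma> s) = w"
proof -
  have "velocity M J \<gamma> s (\<lambda>q. u q $ i) = w $ i" for i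
  proof -
    have "((\<lambda>q. u q $ i) \<circ> chart_inv (U, u)) differentiable (at (u (\<gamma> s)))"
      using coordinate_function_has_derivative[OF charts_is_chart[OF u], of "\<gamma> s" i] s(2)
      unfolding differentiable_def by auto
    then have "differentiable_near M (\<gamma> s) (\<lambda>q. u q $ i)"
      unfolding differentiable_near_def using u s(2) by (intro bexI[of _ "(U, u)"]) auto
    moreover have "((\<lambda>t. u (\<gamma> t) $ i) has_vector_derivative w $ i) (at s within J)"
      using bounded_linear.has_vector_derivative[OF bounded_linear_vec_nth c] .
    then have "vector_derivative (\<lambda>t. u (\<gamma> t) $ i) (at s within J) = w $ i"
      by (rule vector_derivative_within[OF lim])
    ultimately show ?thesis by (simp add: velocity_def)
  qed
  then show ?thesis by (simp add: coord_comp_def vec_eq_iff)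
qed

lemma tangent_basis_spans_components:
  assumes M: "is_atlas M" and c: "c \<in> charts M" and p: "p \<in> fst c" and e: "tangent_basis M p e"
  shows "\<exists>a. b = (\<Sum>i\<in>UNIV. a $ i *\<^sub>R coord_comp c (e i))"
proof -
  have "coord_vec c p b \<in> tangent_space M p" using c p unfolding tangent_space_def by blast
  then obtain a where a: "coord_vec c p b = lincomb a e" using e unfolding tangent_basis_def by blast
  have "b = coord_comp c (lincomb a e)"
    using coord_comp_coord_vec[OF charts_is_chart[OF c] p] a by metis
  also have "\<dots> = (\<Sum>i\<in>UNIV. a $ i *\<^sub>R coord_comp c (e i))"
    by (simp add: vec_eq_iff coord_comp_def lincomb_def)
  finally show ?thesis by blast
qed

text \<open>The neighborhood \<open>V\<close> is the union of all chart domains in \<open>U\<close> on which \<open>\<xi> \<circ> u\<close> is a chart; the work is in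
  showing that the path stays in it.\<close>

theorem proposition6:
  fixes M :: "('m::{t2_space, second_countable_topology}, 'n::finite) chart set"
    and J :: "real set" and \<gamma> :: "real \<Rightarrow> 'm"
    and E :: "'n \<Rightarrow> 'm \<Rightarrow> 'm tvec"
    and S :: "'m tensor_map" and N :: "'m set" and X :: "'m \<Rightarrow> 'm tvec"
    and U :: "'m set" and u :: "'m \<Rightarrow> real^'n"
  assumes "is_atlas M"
    and "C1_path M J \<gamma>"
    and "frame_along M J \<gamma> E"
    and "tensor_map M S"
    and "extends_velocity M J \<gamma> N X"
    and "path_components M S N X J \<gamma> E (\<lambda>s. 0)"
    and "(U, u) \<in> charts M"
    and "U \<inter> \<gamma> ` J \<noteq> {}"
    and "no_self_intersections J \<gamma> U"
  shows "\<exists>V x. open V \<and> U \<inter> \<gamma> ` J \<subseteq> V \<and> V \<subseteq> U \<and> local_coordinates M V x \<and>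
    (\<forall>s\<in>J. \<gamma> s \<in> U \<longrightarrow> (\<forall>G. \<gamma> s \<in> G \<and> (G, x) \<in> charts M \<longrightarrow>
       (\<forall>i. E i (\<gamma> s) = coord_basis (G, x) i (\<gamma> s))))"
proof -
  note M = \<open>is_atlas M\<close> and u = \<open>(U, u) \<in> charts M\<close>
  note uc = charts_is_chart[OF u]
  have opU: "open U" and opuU: "open (u ` U)" and homu: "homeomorphism U (u ` U) u (chart_inv (U, u))"
    using uc by (auto simp: is_chart_def)
  have J: "is_interval J" "interior J \<noteq> {}" and cont: "continuous_on J \<gamma>"
    and C1\<gamma>: "C1_on (J \<inter> \<gamma> -` U) (u \<circ> \<gamma>)"
    using \<open>C1_path M J \<gamma>\<close> u unfolding C1_path_def by auto
  have N: "open N" "\<gamma> ` J \<subseteq> N" "X \<in> C1_fields M N" "\<And>s. s \<in> J \<Longrightarrow> X (\<gamma> s) = velocity M J \<gamma> s"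
    using \<open>extends_velocity M J \<gamma> N X\<close> unfolding extends_velocity_def by auto
  define K where "K = J \<inter> \<gamma> -` U"
  have K: "openin (top_of_set J) K"
    unfolding K_def by (rule continuous_openin_preimage_gen[OF cont opU])
  obtain O' where O': "open O'" "K = J \<inter> O'" using K unfolding openin_open by blast
  have KU: "\<gamma> s \<in> U" "s \<in> J" if "s \<in> K" for s using that by (auto simp: K_def)
  define c where "c s = u (\<gamma> s)" for s
  \<comment> \<open>The coordinate expression of \<open>X\<close>; the coordinate expression \<open>c\<close> of the path is one of its integral curves.\<close>
  define Y where "Y y = coord_comp (U, u) (X (chart_inv (U, u) y))" for y
  have Y: "C1_on (u ` (U \<inter> N)) Y"
    using N(3) u unfolding C1_fields_def Y_def by fastforce
  have cUN: "c s \<in> u ` (U \<inter> N)" if "s \<in> K" for s using KU[OF that] N(2) by (auto simp: c_def)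
  have Yc: "Y (c s) = coord_comp (U, u) (velocity M J \<gamma> s)" if "s \<in> K" for s
    using chart_inv_left[OF uc, of "\<gamma> s"] KU[OF that] N(4) by (simp add: Y_def c_def)
  have C1c: "C1_on K c" using C1\<gamma> by (simp add: K_def c_def[abs_def] comp_def)
  obtain w where w: "\<And>s. s \<in> K \<Longrightarrow> (c has_vector_derivative w s) (at s within K)"
    using C1_on_obtain_vector_derivative[OF C1c] by metis
  have c': "(c has_vector_derivative Y (c s)) (at s within K)" if s: "s \<in> K" for s
  proof -
    have "at s within K = at s within J"
      by (rule at_within_nhd[of s O']) (use s O' in auto)
    then have "(c has_vector_derivative w s) (at s within J)" using w[OF s] by simp
    moreover have "at s within J \<noteq> bot"
    proof -
      have "s islimpt J" unfolding islimpt_approachable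
        using interval_point_near[OF J KU(2)[OF s]] by (metis dist_commute)
      then show ?thesis by (simp add: trivial_limit_within)
    qed
    ultimately have "coord_comp (U, u) (velocity M J \<gamma> s) = w s"
      using velocity_coord_comp[where \<gamma>=\<gamma> and s=s and w="w s", OF u KU(2,1)[OF s]]
      unfolding c_def[abs_def] by blast
    then show ?thesis using w[OF s] Yc[OF s] by simp
  qed
  obtain g where g: "homeomorphism K (U \<inter> \<gamma> ` J) \<gamma> g"
    using \<open>no_self_intersections J \<gamma> U\<close> unfolding no_self_intersections_def K_def by blast
  have "\<gamma> ` K = U \<inter> \<gamma> ` J" by (auto simp: K_def)
  then have "u ` (U \<inter> \<gamma> ` J) = c ` K" by (metis c_def image_cong image_image)
  then have "homeomorphism (U \<inter> \<gamma> ` J) (c ` K) u (chart_inv (U, u))"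
    by (intro homeomorphism_of_subsets[OF homu]) auto
  from homeomorphism_compose[OF g this]
  have hom: "homeomorphism K (c ` K) c (g \<circ> chart_inv (U, u))" by (simp add: c_def[abs_def] comp_def)
  then have inj: "inj_on c K" unfolding homeomorphism_def by (metis inj_on_inverseI)
  have nz: "Y (c s) \<noteq> 0" if s: "s \<in> K" for s
  proof (rule injective_solution_regular[OF J K c' inj s])
    have "open (u ` (U \<inter> N))"
      using chart_open_image[OF uc, of "U \<inter> N"] opU N(1) by auto
    moreover obtain Y' where "(Y has_derivative blinfun_apply (Y' (c s))) (at (c s) within u ` (U \<inter> N))"
      by (rule C1_on_derivative[OF Y]) (use cUN[OF s] in blast)
    ultimately show "Y differentiable at (c s)"
      using at_within_open[OF cUN[OF s]] unfolding differentiable_def by auto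
  qed
  define e where "e i s = coord_comp (U, u) (E i (\<gamma> s))" for i s
  have basis: "tangent_basis M (\<gamma> s) (\<lambda>i. E i (\<gamma> s))" if "s \<in> K" for s
    using \<open>frame_along M J \<gamma> E\<close> KU(2)[OF that] unfolding frame_along_def by blast
  have e: "C1_on K (e i)" for i
    using \<open>frame_along M J \<gamma> E\<close> u unfolding frame_along_def K_def e_def by fastforce
  have span: "\<exists>a. b = (\<Sum>i\<in>UNIV. a $ i *\<^sub>R e i s)" if "s \<in> K" for s b
    unfolding e_def using tangent_basis_spans_components[OF M u _ basis[OF that]] KU(1)[OF that] by simp
  obtain T :: "real \<Rightarrow> (real^'n) \<Rightarrow>\<^sub>L (real^'n)" where T: "C1_on K T" "\<And>s. s \<in> K \<Longrightarrow> inj (T s)"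
    "\<And>s i. s \<in> K \<Longrightarrow> T s (e i s) = axis i 1"
    using C1_dual_frame[OF e span] by metis
  \<comment> \<open>The derivative of \<open>c\<close> is \<open>Y \<circ> c\<close>, which makes \<open>c\<close> itself of class two.\<close>
  have "C1_on K (\<lambda>s. Y (c s))"
    by (rule C1_on_compose[OF Y C1c]) (use cUN in blast)
  then obtain W \<xi> where W: "open W" "c ` K \<subseteq> W" "C2_on W \<xi>"
    and \<xi>: "\<And>s. s \<in> K \<Longrightarrow> (\<xi> has_derivative T s) (at (c s))"
    using C2_prescribed_derivative_along_curve[OF J(1) K c' _ nz hom T(1)] by metis
  define x where "x = \<xi> \<circ> u"
  define V where "V = \<Union>{G. G \<subseteq> U \<and> (G, x) \<in> charts M}"
  have "open V"
    unfolding V_def using charts_is_chart by (fastforce simp: is_chart_def)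
  moreover have "\<gamma> s \<in> V" if s: "s \<in> K" for s
  proof -
    obtain G where "\<gamma> s \<in> G" "G \<subseteq> U" "(G, \<xi> \<circ> u) \<in> charts M"
      using chart_of_local_diffeomorphism[OF M u KU(1)[OF s] W(1) _ W(3)] \<xi>[OF s] T(2)[OF s] W(2) s unfolding c_def by blast
    then show ?thesis unfolding V_def x_def by blast
  qed
  then have "U \<inter> \<gamma> ` J \<subseteq> V" by (auto simp: K_def)
  moreover have "V \<subseteq> U" "local_coordinates M V x"
    unfolding V_def local_coordinates_def by blast+
  moreover have "E i (\<gamma> s) = coord_basis (G, x) i (\<gamma> s)"
    if "s \<in> J" "\<gamma> s \<in> U" and G: "\<gamma> s \<in> G" "(G, x) \<in> charts M" for s G i
  proof -
    have s: "s \<in> K" using that by (simp add: K_def)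
    have "E i (\<gamma> s) \<in> tangent_space M (\<gamma> s)" using basis[OF s] unfolding tangent_basis_def by blast
    then have "E i (\<gamma> s) = coord_vec (U, u) (\<gamma> s) (e i s)"
      using tangent_space_coord_vec[OF M u] KU(1)[OF s] unfolding e_def by simp
    moreover have "((\<lambda>y. x (chart_inv (U, u) y)) has_derivative T s) (at (u (\<gamma> s)))"
    proof (rule has_derivative_transform_within_open[OF _ opuU])
      show "(\<xi> has_derivative T s) (at (u (\<gamma> s)))" using \<xi>[OF s] by (simp add: c_def)
      show "u (\<gamma> s) \<in> u ` U" using KU(1)[OF s] by blast
      show "\<xi> y = x (chart_inv (U, u) y)" if "y \<in> u ` U" for y
        using chart_inv_right[of y "(U, u)"] that by (simp add: x_def)
    qed
    ultimately have "E i (\<gamma> s) = coord_vec (G, x) (\<gamma> s) (T s (e i s))"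
      using coord_vec_change[OF M u G(2), of "\<gamma> s" "T s" "e i s"] KU(1)[OF s] G(1) by simp
    then show ?thesis using T(3)[OF s] by (simp add: coord_basis_def)
  qed
  ultimately show ?thesis by blast
qed

end
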